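(* Let $n$ be a positive integer and write $2n+3=3^{\beta}n_1$ with $n_1$ a positive integer and $3\nmid n_1$. Then $$t(1,2,3,6;n)=2(3^{\beta+1}-2)\sigma(n_1)-2a(2n+3).$$
   Context: $\sigma(n)=\sum_{d\mid n,\,d\ge1}d$. The integers $a(n)$ ($n\ge1$) are defined by $q\prod_{k=1}^{\infty}(1-q^{2k})(1-q^{4k})(1-q^{6k})(1-q^{12k})=\sum_{n=1}^{\infty}a(n)q^n$ for $|q|<1$. For positive integers $a,b,c,d$ and a nonnegative integer $n$, $t(a,b,c,d;n)$ denotes the number of $(x,y,z,w)\in\mathbb Z^4$ with $n=a\frac{x(x-1)}2+b\frac{y(y-1)}2+c\frac{z(z-1)}2+d\frac{w(w-1)}2$. *)

theory Defs
  imports "HOL-Analysis.Analysis" "HOL-Computational_Algebra.Polynomial"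
begin

definition divisor_sigma :: "nat \<Rightarrow> nat" where
  "divisor_sigma n = (\<Sum>d | d dvd n. d)"

text \<open>The integer division is exact, since a product of consecutive integers is even.\<close>

definition tri_reps :: "nat \<Rightarrow> nat \<Rightarrow> nat \<Rightarrow> nat \<Rightarrow> nat \<Rightarrow> (int \<times> int \<times> int \<times> int) set" where
  "tri_reps a b c d n =
     {(x, y, z, w). int n = int a * (x * (x - 1) div 2) + int b * (y * (y - 1) div 2)
                          + int c * (z * (z - 1) div 2) + int d * (w * (w - 1) div 2)}"

definition tri_count :: "nat \<Rightarrow> nat \<Rightarrow> nat \<Rightarrow> nat \<Rightarrow> nat \<Rightarrow> nat" where
  "tri_count a b c d n = card (tri_reps a b c d n)"

lemma tri_bound:
  fixes x :: int
  assumes "x * (x - 1) div 2 \<le> N"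
  shows "x \<in> {- N - 1..N + 1}"
proof -
  have e: "x * (x - 1) = 2 * (x * (x - 1) div 2)"
    by (simp add: even_mult_iff)
  hence le: "x * (x - 1) \<le> 2 * N" using assms by linarith
  have "0 \<le> (x - 1) * (x - 2)"
  proof (cases "x \<le> 1")
    case True
    thus ?thesis by (intro mult_nonpos_nonpos) auto
  qed (auto intro!: mult_nonneg_nonneg)
  moreover have "0 \<le> x * (x + 1)"
  proof (cases "x \<le> -1")
    case True
    thus ?thesis by (intro mult_nonpos_nonpos) auto
  qed (auto intro!: mult_nonneg_nonneg)
  ultimately show ?thesis using le by (simp add: algebra_simps)
qed

lemma tri_nonneg: "0 \<le> x * (x - 1) div 2" for x :: int
proof -
  have "0 \<le> x * (x - 1)"
  proof (cases "x \<le> 0")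
    case True
    thus ?thesis by (intro mult_nonpos_nonpos) auto
  qed (auto intro!: mult_nonneg_nonneg)
  thus ?thesis by simp
qed

lemma finite_tri_reps:
  assumes "a > 0" "b > 0" "c > 0" "d > 0"
  shows "finite (tri_reps a b c d n)"
proof (rule finite_subset)
  let ?I = "{- int n - 1..int n + 1}"
  show "finite (?I \<times> ?I \<times> ?I \<times> ?I)" by simp
  have ge: "u \<le> int m * u" "0 \<le> int m * u" if "m > 0" "0 \<le> u" for m u
    using that mult_right_mono[of 1 "int m" u] by auto
  show "tri_reps a b c d n \<subseteq> ?I \<times> ?I \<times> ?I \<times> ?I"
  proof
    fix v assume v: "v \<in> tri_reps a b c d n"
    obtain x y z w where [simp]: "v = (x, y, z, w)" by (cases v)
    from v have eq: "int n = int a * (x * (x - 1) div 2) + int b * (y * (y - 1) div 2)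
                          + int c * (z * (z - 1) div 2) + int d * (w * (w - 1) div 2)"
      by (simp add: tri_reps_def)
    note g = ge[OF assms(1) tri_nonneg[of x]] ge[OF assms(2) tri_nonneg[of y]]
             ge[OF assms(3) tri_nonneg[of z]] ge[OF assms(4) tri_nonneg[of w]]
    have "x * (x - 1) div 2 \<le> int n" "y * (y - 1) div 2 \<le> int n"
         "z * (z - 1) div 2 \<le> int n" "w * (w - 1) div 2 \<le> int n"
      using eq g by linarith+
    hence "x \<in> ?I" "y \<in> ?I" "z \<in> ?I" "w \<in> ?I" using tri_bound by blast+
    thus "v \<in> ?I \<times> ?I \<times> ?I \<times> ?I" by simp
  qed
qed

text \<open>
  The product is indexed from \<open>0\<close>, so its \<open>k\<close>-th factor belongs to \<open>k + 1\<close>. Since the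
  expansion starts at \<open>q\<close>, the value at \<open>0\<close> is fixed to be \<open>0\<close>.
\<close>

definition is_eta_coeffs :: "(nat \<Rightarrow> int) \<Rightarrow> bool" where
  "is_eta_coeffs a \<longleftrightarrow> a 0 = 0 \<and>
     (\<forall>q::complex. norm q < 1 \<longrightarrow>
        (\<lambda>n. of_int (a (Suc n)) * q ^ Suc n) sums
          (q * (\<Prod>k. (1 - q ^ (2 * Suc k)) * (1 - q ^ (4 * Suc k))
                   * (1 - q ^ (6 * Suc k)) * (1 - q ^ (12 * Suc k)))))"

definition eta_coeff :: "nat \<Rightarrow> int" where
  "eta_coeff = (THE a. is_eta_coeffs a)"

text \<open>
  Existence and uniqueness behind the definite description: the coefficients of the partial
  products (\<open>s = - 1\<close>) stabilise and are dominated by those of the same products with plus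
  signs (\<open>s = 1\<close>), so that limit and summation can be exchanged.
\<close>

definition eta_fac :: "'a::comm_ring_1 \<Rightarrow> 'a \<Rightarrow> nat \<Rightarrow> 'a" where
  "eta_fac s x k = (1 + s * x ^ (2 * Suc k)) * (1 + s * x ^ (4 * Suc k))
                   * (1 + s * x ^ (6 * Suc k)) * (1 + s * x ^ (12 * Suc k))"

definition eta_poly :: "'a::comm_ring_1 \<Rightarrow> nat \<Rightarrow> 'a poly" where
  "eta_poly s N = [:0, 1:] * (\<Prod>k<N. eta_fac [:s:] [:0, 1:] k)"

lemma eta_fac_expand: "\<exists>r. eta_fac s x k = 1 + x ^ Suc k * r"
proof -
  have p: "x ^ (m * Suc k) = x ^ Suc k * x ^ ((m - 1) * Suc k)" if "m > 0" for m
    using that by (cases m) (simp_all add: power_add)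
  have e: "(1 + s * (y * A)) * (1 + s * (y * B)) * (1 + s * (y * C)) * (1 + s * (y * D))
    = 1 + y * (s * A * (1 + s * (y * B)) * (1 + s * (y * C)) * (1 + s * (y * D))
       + s * B * (1 + s * (y * C)) * (1 + s * (y * D)) + s * C * (1 + s * (y * D)) + s * D)"
    for y A B C D :: 'a
    by (simp add: algebra_simps)
  show ?thesis
    unfolding eta_fac_def p[of 2, OF zero_less_numeral] p[of 4, OF zero_less_numeral]
      p[of 6, OF zero_less_numeral] p[of 12, OF zero_less_numeral] e
    by blast
qed

lemma poly_eta_fac: "poly (eta_fac [:s:] [:0, 1:] k) x = eta_fac s x k"
  by (simp only: eta_fac_def poly_mult poly_add poly_power poly_1) simp

lemma poly_eta_poly: "poly (eta_poly s N) x = x * (\<Prod>k<N. eta_fac s x k)"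
  by (simp add: eta_poly_def poly_prod poly_eta_fac)

lemma coeff_eta_poly_stable:
  assumes "n \<le> N"
  shows "coeff (eta_poly s N) n = coeff (eta_poly s n) n"
  using assms
proof (induction N rule: dec_induct)
  case (step N)
  obtain r where r: "eta_fac [:s:] [:0, 1:] N = 1 + [:0, 1:] ^ Suc N * r"
    using eta_fac_expand by blast
  have "eta_poly s (Suc N) = eta_poly s N + monom 1 (Suc N) * (eta_poly s N * r)"
    by (simp only: eta_poly_def prod.lessThan_Suc r monom_altdef smult_1_left)
       (simp only: algebra_simps mult_1_left mult_1_right)
  hence "coeff (eta_poly s (Suc N)) n = coeff (eta_poly s N) n"
    using step.hyps by (simp only: coeff_add coeff_monom_mult) simp
  thus ?case using step.IH by simp
qed simp

definition pdom :: "complex poly \<Rightarrow> real poly \<Rightarrow> bool" where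
  "pdom p q \<longleftrightarrow> (\<forall>n. coeff p n \<in> \<int> \<and> norm (coeff p n) \<le> coeff q n)"

lemma pdomD: "pdom p q \<Longrightarrow> 0 \<le> coeff q n"
  unfolding pdom_def using norm_ge_zero order_trans by blast

lemma pdom_mult:
  assumes "pdom p q" "pdom p' q'"
  shows "pdom (p * p') (q * q')"
  using assms pdomD[OF assms(1)] unfolding pdom_def coeff_mult
  by (auto intro!: Ints_sum Ints_mult sum_norm_le mult_mono simp: norm_mult)

lemma pdom_prod: "(\<And>k. pdom (f k) (g k)) \<Longrightarrow> pdom (\<Prod>k<N::nat. f k) (\<Prod>k<N. g k)"
proof (induction N)
  case 0
  show ?case by (auto simp: pdom_def coeff_1)
qed (auto intro: pdom_mult)

lemma pdom_lin: "pdom (1 + [:- 1:] * [:0, 1:] ^ m) (1 + [:1:] * [:0, 1:] ^ m)"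
proof -
  have "[:- 1:] * [:0, 1:] ^ m = monom (- 1 :: complex) m" "[:1:] * [:0, 1:] ^ m = monom (1 :: real) m"
    by (simp_all add: monom_altdef)
  thus ?thesis by (auto simp: pdom_def coeff_1 simp del: mult_pCons_left)
qed

lemma pdom_eta_fac: "pdom (eta_fac [:- 1:] [:0, 1:] k) (eta_fac [:1:] [:0, 1:] k)"
  unfolding eta_fac_def by (intro pdom_mult pdom_lin)

lemma pdom_eta_poly: "pdom (eta_poly (- 1) N) (eta_poly 1 N)"
  unfolding eta_poly_def
  by (intro pdom_mult pdom_prod pdom_eta_fac) (auto simp: pdom_def coeff_pCons split: nat.splits)

lemma coeff_eta_poly_mono_Suc:
  "coeff (eta_poly (1::real) N) n \<le> coeff (eta_poly 1 (Suc N)) n"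
proof -
  let ?F = "eta_fac [:1::real:] [:0, 1:] N"
  have F0: "coeff ?F 0 = 1"
    unfolding poly_0_coeff_0[symmetric] poly_eta_fac by (simp add: eta_fac_def power_0_left)
  have eq: "eta_poly 1 (Suc N) = eta_poly 1 N * ?F"
    by (simp add: eta_poly_def mult_ac)
  have "coeff (eta_poly 1 N) n = (\<Sum>i\<in>{n}. coeff (eta_poly 1 N) i * coeff ?F (n - i))"
    by (simp add: F0)
  also have "\<dots> \<le> (\<Sum>i\<le>n. coeff (eta_poly 1 N) i * coeff ?F (n - i))"
    by (intro sum_mono2 mult_nonneg_nonneg pdomD[OF pdom_eta_poly] pdomD[OF pdom_eta_fac]) auto
  finally show ?thesis unfolding eq coeff_mult .
qed

lemma coeff_eta_poly_le: "coeff (eta_poly (1::real) N) n \<le> coeff (eta_poly 1 n) n"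
proof (cases "n \<le> N")
  case True
  thus ?thesis using coeff_eta_poly_stable[of n N "1::real"] by simp
next
  case False
  hence "N \<le> n" by simp
  with coeff_eta_poly_mono_Suc show ?thesis
    by (rule lift_Suc_mono_le[of "\<lambda>N. coeff (eta_poly 1 N) n"])
qed

lemma poly_sums:
  fixes x :: "'a::{real_normed_field}"
  shows "(\<lambda>i. coeff p i * x ^ i) sums poly p x"
  unfolding poly_altdef by (rule sums_finite) (auto simp: coeff_eq_0)

lemma convergent_prod_eta_fac:
  fixes x s :: "'a::{real_normed_field,banach}"
  assumes "norm x < 1"
  shows "convergent_prod (eta_fac s x)"
proof -
  have lin: "convergent_prod (\<lambda>k. 1 + s * x ^ (m * Suc k))" if "m > 0" for m
  proof -
    have "norm (x ^ m) < 1"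
      using assms that by (simp add: norm_power power_less_one_iff)
    hence "summable (\<lambda>k. norm s * norm (x ^ m) ^ Suc k)"
      by (intro summable_mult) (auto simp only: summable_Suc_iff real_norm_def abs_norm_cancel intro!: summable_geometric)
    hence "summable (\<lambda>k. norm (1 + s * x ^ (m * Suc k) - 1))"
      by (simp only: norm_mult norm_power power_mult add_diff_cancel_left')
    thus ?thesis
      by (intro abs_convergent_prod_imp_convergent_prod summable_imp_abs_convergent_prod)
  qed
  show ?thesis unfolding eta_fac_def by (intro convergent_prod_mult lin) auto
qed

lemma prod_eta_fac_LIMSEQ:
  fixes x s :: "'a::{real_normed_field,banach}"
  assumes "norm x < 1"
  shows "(\<lambda>N. \<Prod>k<N. eta_fac s x k) \<longlonglongrightarrow> (\<Prod>k. eta_fac s x k)"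
proof -
  have "(\<lambda>N. \<Prod>k<Suc N. eta_fac s x k) \<longlonglongrightarrow> (\<Prod>k. eta_fac s x k)"
    unfolding lessThan_Suc_atMost
    by (rule convergent_prod_LIMSEQ[OF convergent_prod_eta_fac[OF assms]])
  thus ?thesis by (subst (asm) filterlim_sequentially_Suc)
qed

lemma summable_eta_majorant:
  assumes "0 \<le> r" "r < (1::real)"
  shows "summable (\<lambda>n. coeff (eta_poly 1 n) n * r ^ n)"
proof -
  have "(\<lambda>m. poly (eta_poly 1 m) r) \<longlonglongrightarrow> r * (\<Prod>k. eta_fac 1 r k)"
    unfolding poly_eta_poly using assms by (intro tendsto_intros prod_eta_fac_LIMSEQ) auto
  from convergent_imp_Bseq[OF convergentI[OF this]]
  obtain K where K: "\<And>m. \<bar>poly (eta_poly 1 m) r\<bar> \<le> K"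
    unfolding Bseq_def real_norm_def by blast
  show ?thesis
  proof (rule bounded_imp_summable)
    fix m :: nat
    show "0 \<le> coeff (eta_poly 1 m) m * r ^ m"
      using assms by (intro mult_nonneg_nonneg pdomD[OF pdom_eta_poly]) auto
    have "(\<Sum>n\<le>m. coeff (eta_poly 1 n) n * r ^ n) = (\<Sum>n\<le>m. coeff (eta_poly 1 m) n * r ^ n)"
      by (intro sum.cong refl arg_cong2[of _ _ _ _ "(*)"] coeff_eta_poly_stable[symmetric]) auto
    also have "\<dots> \<le> (\<Sum>n. coeff (eta_poly 1 m) n * r ^ n)"
      using assms
      by (intro sum_le_suminf sums_summable[OF poly_sums] mult_nonneg_nonneg
            pdomD[OF pdom_eta_poly]) auto
    also have "\<dots> = poly (eta_poly 1 m) r"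
      by (rule sums_unique[OF poly_sums, symmetric])
    also have "\<dots> \<le> K" using K[of m] by linarith
    finally show "(\<Sum>n\<le>m. coeff (eta_poly 1 n) n * r ^ n) \<le> K" .
  qed
qed

lemma eta_sums:
  fixes q :: complex
  assumes "norm q < 1"
  shows "(\<lambda>n. coeff (eta_poly (- 1) n) n * q ^ n) sums (q * (\<Prod>k. eta_fac (- 1) q k))"
proof -
  let ?M = "\<lambda>n. coeff (eta_poly 1 n) n * norm q ^ n"
  let ?b = "\<lambda>n. coeff (eta_poly (- 1) n) n * q ^ n"
  have bd: "norm (coeff (eta_poly (- 1) N) n * q ^ n) \<le> ?M n" for N n
  proof -
    have "norm (coeff (eta_poly (- 1 :: complex) N) n) \<le> coeff (eta_poly 1 N) n"
      using pdom_eta_poly[of N] unfolding pdom_def by blast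
    also note coeff_eta_poly_le
    finally show ?thesis by (auto simp: norm_mult norm_power intro: mult_right_mono)
  qed
  have lim: "(\<lambda>N. coeff (eta_poly (- 1) N) n * q ^ n) \<longlonglongrightarrow> ?b n" for n
    by (rule tendsto_eventually, rule eventually_sequentiallyI[of n],
        rule arg_cong2[of _ _ _ _ "(*)", OF coeff_eta_poly_stable refl])
  have T: "summable (\<lambda>n. norm (?b n)) \<and>
     (\<lambda>N. \<Sum>n. coeff (eta_poly (- 1) N) n * q ^ n) \<longlonglongrightarrow> suminf ?b"
    using tannerys_theorem[of "\<lambda>n N. coeff (eta_poly (- 1) N) n * q ^ n" ?b sequentially ?M]
      lim bd summable_eta_majorant[of "norm q"] assms
    by (auto intro!: always_eventually)
  have "(\<lambda>N. poly (eta_poly (- 1) N) q) \<longlonglongrightarrow> suminf ?b"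
    using T by (simp only: sums_unique[OF poly_sums, symmetric])
  moreover have "(\<lambda>N. poly (eta_poly (- 1) N) q) \<longlonglongrightarrow> q * (\<Prod>k. eta_fac (- 1) q k)"
    unfolding poly_eta_poly using assms by (intro tendsto_intros prod_eta_fac_LIMSEQ)
  ultimately have "suminf ?b = q * (\<Prod>k. eta_fac (- 1) q k)"
    by (rule LIMSEQ_unique)
  thus ?thesis using T summable_norm_cancel[of ?b] by (auto simp: sums_iff)
qed

lemma is_eta_coeffs_altdef:
  "is_eta_coeffs a \<longleftrightarrow> a 0 = 0 \<and>
     (\<forall>q::complex. norm q < 1 \<longrightarrow>
        (\<lambda>n. of_int (a n) * q ^ n) sums (q * (\<Prod>k. eta_fac (- 1) q k)))"
proof -
  have "(\<lambda>n. of_int (a (Suc n)) * q ^ Suc n) sums s \<longleftrightarrow> (\<lambda>n. of_int (a n) * q ^ n) sums s"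
    if "a 0 = 0" for q s :: complex
    using sums_Suc_iff[of "\<lambda>n. of_int (a n) * q ^ n" s] that by simp
  thus ?thesis unfolding is_eta_coeffs_def eta_fac_def by auto
qed

lemma is_eta_coeffs_ex1: "\<exists>!a. is_eta_coeffs a"
proof (rule ex_ex1I)
  have "\<forall>n. \<exists>z::int. coeff (eta_poly (- 1 :: complex) n) n = of_int z"
    using pdom_eta_poly unfolding pdom_def by (metis Ints_cases)
  then obtain a :: "nat \<Rightarrow> int"
    where a: "\<And>n. coeff (eta_poly (- 1 :: complex) n) n = of_int (a n)" by metis
  have "coeff (eta_poly (- 1 :: complex) 0) 0 = 0" by (simp add: eta_poly_def)
  hence "a 0 = 0" using a[of 0] by simp
  thus "\<exists>a. is_eta_coeffs a"
    unfolding is_eta_coeffs_altdef using eta_sums a by (intro exI[of _ a]) simp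
next
  fix a b assume ab: "is_eta_coeffs a" "is_eta_coeffs b"
  define F where "F = (\<lambda>a::nat \<Rightarrow> int. Abs_fps (\<lambda>n. of_int (a n) :: complex))"
  have rad: "fps_conv_radius (F a) > 0" if "is_eta_coeffs a" for a
  proof -
    have "summable (\<lambda>n. of_int (a n) * (1 / 2 :: complex) ^ n)"
      using that unfolding is_eta_coeffs_altdef by (auto simp: sums_iff norm_divide)
    from conv_radius_geI[OF this] show ?thesis
      by (auto simp: F_def fps_conv_radius_def norm_divide intro: less_le_trans[rotated])
  qed
  have ev: "eval_fps (F a) q = q * (\<Prod>k. eta_fac (- 1) q k)"
    if "is_eta_coeffs a" "norm q < 1" for a q
    using that unfolding is_eta_coeffs_altdef eval_fps_def F_def by (auto simp: sums_iff)
  have "eventually (\<lambda>q::complex. q \<in> ball 0 1) (nhds 0)"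
    by (intro eventually_nhds_in_open) auto
  hence "eventually (\<lambda>q. eval_fps (F a) q = eval_fps (F b) q) (nhds 0)"
    by eventually_elim (simp add: ev ab)
  hence "F a = F b" by (intro eval_fps_eqD rad ab)
  thus "a = b" by (auto simp: F_def fps_eq_iff fun_eq_iff)
qed

lemma is_eta_coeffs_eta_coeff: "is_eta_coeffs eta_coeff"
  unfolding eta_coeff_def by (rule theI'[OF is_eta_coeffs_ex1])

end

theory Submission
  imports Defs "HOL-Computational_Algebra.Formal_Laurent_Series" "HOL-Computational_Algebra.Polynomial_FPS"
begin

text \<open>
  With \<open>\<psi>(q) = \<Sum>\<^bsub>k\<ge>0\<^esub> q^(k(k+1)/2)\<close>, \<open>\<phi>(q) = \<Sum>\<^bsub>k\<^esub> q^(k^2)\<close> and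
  \<open>a(q) = \<Sum>\<^bsub>u,v\<^esub> q^(u^2+uv+v^2)\<close>, the generating function of the representation numbers is
  \<open>16 \<psi>(q) \<psi>(q^2) \<psi>(q^3) \<psi>(q^6)\<close>, and the theorem is equivalent to comparing coefficients in
  \<open>\<psi>(q)^4 + 3 q \<psi>(q^3)^4 = a(q) \<psi>(q) \<psi>(q^3)
     = \<phi>(-q) \<psi>(q) \<phi>(-q^3) \<psi>(q^3) + 8 q \<psi>(q) \<psi>(q^2) \<psi>(q^3) \<psi>(q^6)\<close>.
  On the left, \<open>\<psi>(q)^4 = \<Sum> \<sigma>(2n+1) q^n\<close> follows from a Liouville-type involution.
  The first equality combines the Hecke relation \<open>\<sigma>(3N) + 3 \<sigma>(N/3) = 4 \<sigma>(N)\<close> with the splitting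
  of three-variable sums into a line and a hexagonal plane; the second is a change of lattice
  variables. Finally \<open>\<phi>(-q) \<psi>(q) = \<Prod> (1 - q^k) (1 - q^(2k))\<close> by Gauss's product for \<open>\<psi>\<close>, which
  turns the first summand into the eta product (with \<open>q^2\<close> replaced by \<open>q\<close>).
\<close>

subsection \<open>A Liouville-type identity\<close>

definition liouville_set :: "nat \<Rightarrow> (int \<times> int \<times> int) set" where
  "liouville_set n = {(x, d, e). 0 < d \<and> 0 < e \<and> x * (x - 1) + d * e = 2 * int n + 1}"

lemma finite_liouville_set: "finite (liouville_set n)"
proof (rule finite_subset)
  let ?I = "{- int n - 1..int n + 1}" and ?J = "{1..2 * int n + 1}"
  show "finite (?I \<times> ?J \<times> ?J)" by simp
  show "liouville_set n \<subseteq> ?I \<times> ?J \<times> ?J"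
  proof
    fix v assume v: "v \<in> liouville_set n"
    obtain x d e where [simp]: "v = (x, d, e)" by (cases v)
    have *: "0 < d" "0 < e" "x * (x - 1) + d * e = 2 * int n + 1"
      using v by (auto simp: liouville_set_def)
    have t: "x * (x - 1) = 2 * (x * (x - 1) div 2)" by (simp add: even_mult_iff)
    have "d * e \<ge> d" "d * e \<ge> e" using * by (auto simp: mult_le_cancel_left1 mult_le_cancel_right1)
    with * t tri_nonneg[of x] have "x * (x - 1) div 2 \<le> int n" "d \<le> 2 * int n + 1" "e \<le> 2 * int n + 1"
      by linarith+
    with * tri_bound show "v \<in> ?I \<times> ?J \<times> ?J" by auto
  qed
qed

text \<open>
  Writing \<open>i = 2x - 1\<close>, the equation reads \<open>i^2 + 4de = 8n + 5\<close>. On the half \<open>U\<close> where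
  \<open>f = e - d - i\<close> is positive it becomes \<open>(d + e + f)^2 - 4ef = 8n + 5\<close>, which is symmetric in
  \<open>e\<close> and \<open>f\<close>; exchanging these two is the involution \<open>r\<close> below. The antisymmetric weight \<open>l\<close> is
  chosen so that \<open>k - l\<close> changes sign under \<open>r\<close>.
\<close>

lemma sum_liouville_set:
  "(\<Sum>(x, d, e)\<in>liouville_set n. d * (d * e - (2 * x - 1)\<^sup>2)) = 0"
proof -
  let ?S = "liouville_set n"
  define U where "U = {(x, d, e)\<in>?S. 0 < e - d - (2 * x - 1)}"
  define h where "h = (\<lambda>(x::int, d::int, e::int). d * (d * e - (2 * x - 1)\<^sup>2))"
  define k where "k = (\<lambda>(x::int, d::int, e::int). (d + e) * (d * e - (2 * x - 1)\<^sup>2))"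
  define l where "l = (\<lambda>(x::int, d::int, e::int). (2 * x - 1) * (d\<^sup>2 - e\<^sup>2))"
  have U: "U \<subseteq> ?S" by (auto simp: U_def)
  have fin: "finite U" using finite_subset[OF U finite_liouville_set] .
  \<comment> \<open>Otherwise d and e = d + i have opposite parity, as i = 2x - 1 is odd; then d e
    and x (x - 1) are both even, but their sum is odd.\<close>
  have nz: "e - d - (2 * x - 1) \<noteq> 0" if "(x, d, e) \<in> ?S" for x d e
  proof
    assume "e - d - (2 * x - 1) = 0"
    hence e: "e = d + 2 * x - 1" by simp
    have "even (d * e)" by (simp add: e)
    moreover have "even (x * (x - 1))" by simp
    ultimately have "even (x * (x - 1) + d * e)" by simp
    moreover have "x * (x - 1) + d * e = 2 * int n + 1" using that by (simp add: liouville_set_def)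
    ultimately show False by simp
  qed
  \<comment> \<open>Swapping d and e together with i -> -i negates f, so it exchanges
    \<open>U\<close> with its complement.\<close>
  have split: "sum g ?S = (\<Sum>(x, d, e)\<in>U. g (x, d, e) + g (1 - x, e, d))" for g :: "int \<times> int \<times> int \<Rightarrow> int"
  proof -
    have "sum g (?S - U) = (\<Sum>(x, d, e)\<in>U. g (1 - x, e, d))"
      by (rule sum.reindex_bij_witness[of _ "\<lambda>(x, d, e). (1 - x, e, d)" "\<lambda>(x, d, e). (1 - x, e, d)"])
         (use nz in \<open>force simp: U_def liouville_set_def algebra_simps\<close>)+
    with sum.subset_diff[OF U finite_liouville_set, of g] show ?thesis
      by (simp add: sum.distrib case_prod_unfold)
  qed
  \<comment> \<open>\<open>l\<close> is odd under i -> -i and invariant under the map used in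
    \<open>split\<close>: the first makes its sum over the full set vanish, the second folds that
    sum onto \<open>U\<close>.\<close>
  have "sum l ?S = (\<Sum>v\<in>?S. - l v)"
    by (rule sum.reindex_bij_witness[of _ "\<lambda>(x, d, e). (1 - x, d, e)" "\<lambda>(x, d, e). (1 - x, d, e)"])
       (auto simp: liouville_set_def l_def algebra_simps)
  hence "sum l ?S = 0" by (simp add: sum_negf)
  moreover have "sum l ?S = (\<Sum>v\<in>U. 2 * l v)"
    unfolding split by (intro sum.cong) (auto simp: l_def algebra_simps)
  ultimately have l0: "sum l U = 0" by (simp add: sum_distrib_left[symmetric])
  define r where "r = (\<lambda>(x::int, d::int, e::int). (1 - x - d, d, e - d - (2 * x - 1)))"
  have r: "r v \<in> U" "r (r v) = v" "- (k (r v) - l (r v)) = k v - l v" if "v \<in> U" for v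
  proof -
    obtain x d e where v: "v = (x, d, e)" by (cases v)
    have "(1 - x - d) * (1 - x - d - 1) + d * (e - d - (2 * x - 1)) = x * (x - 1) + d * e"
      by (simp add: algebra_simps)
    with that show "r v \<in> U" by (auto simp: v r_def U_def liouville_set_def)
    show "r (r v) = v" by (simp add: v r_def)
    show "- (k (r v) - l (r v)) = k v - l v"
      by (simp add: v r_def k_def l_def algebra_simps power2_eq_square)
  qed
  have "(\<Sum>v\<in>U. k v - l v) = (\<Sum>v\<in>U. - (k v - l v))"
    by (rule sum.reindex_bij_witness[of _ r r]) (use r in auto)
  hence "(\<Sum>v\<in>U. k v - l v) = 0" by (simp only: sum_negf)
  hence "sum k U = 0" using l0 by (simp add: sum_subtractf)
  moreover have "sum h ?S = sum k U"
    unfolding split by (intro sum.cong) (auto simp: h_def k_def algebra_simps power2_eq_square)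
  ultimately show ?thesis by (simp add: h_def)
qed

subsection \<open>Generating functions of weighted sets\<close>

definition finite_fibres :: "'b set \<Rightarrow> ('b \<Rightarrow> nat) \<Rightarrow> bool" where
  "finite_fibres S f \<longleftrightarrow> (\<forall>n. finite {x \<in> S. f x = n})"

text \<open>The factor \<open>e ^ n\<close> replaces q by e q, so \<open>e = - 1\<close> yields
  series such as phi(-q). An infinite fibre would count as 0, hence the \<open>finite_fibres\<close>
  hypotheses below.\<close>

definition gen_fps :: "'a::comm_ring_1 \<Rightarrow> 'b set \<Rightarrow> ('b \<Rightarrow> nat) \<Rightarrow> 'a fps" where
  "gen_fps e S f = Abs_fps (\<lambda>n. e ^ n * of_nat (card {x \<in> S. f x = n}))"

lemma gen_fps_nth [simp]: "gen_fps e S f $ n = e ^ n * of_nat (card {x \<in> S. f x = n})"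
  by (simp add: gen_fps_def)

lemma finite_fibres_int:
  assumes "\<And>x::int. \<bar>x\<bar> \<le> int (f x) + 1"
  shows "finite_fibres S f"
  unfolding finite_fibres_def
proof
  fix n
  have "- int (f x) - 1 \<le> x \<and> x \<le> int (f x) + 1" for x using assms[of x] by linarith
  hence "{x \<in> S. f x = n} \<subseteq> {- int n - 1..int n + 1}" by auto
  thus "finite {x \<in> S. f x = n}" by (rule finite_subset) simp
qed

lemma finite_fibres_subset: "finite_fibres T f \<Longrightarrow> S \<subseteq> T \<Longrightarrow> finite_fibres S f"
  unfolding finite_fibres_def by (auto elim!: rev_finite_subset)

lemma finite_fibres_scale: "finite_fibres S f \<Longrightarrow> k > 0 \<Longrightarrow> finite_fibres S (\<lambda>x. k * f x)"
  unfolding finite_fibres_def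
proof
  fix n assume *: "\<forall>n. finite {x \<in> S. f x = n}" "k > 0"
  have "{x \<in> S. k * f x = n} \<subseteq> {x \<in> S. f x = n div k}" using *(2) by auto
  thus "finite {x \<in> S. k * f x = n}" using *(1) finite_subset by blast
qed

lemma
  assumes "finite_fibres S f" "finite_fibres T g"
  shows finite_fibres_times: "finite_fibres (S \<times> T) (\<lambda>(x, y). f x + g y)"
    and gen_fps_times: "gen_fps e (S \<times> T) (\<lambda>(x, y). f x + g y) = gen_fps e S f * gen_fps e T g"
proof -
  have eq: "{v \<in> S \<times> T. (\<lambda>(x, y). f x + g y) v = n} =
    (\<Union>i\<in>{0..n}. {x \<in> S. f x = i} \<times> {y \<in> T. g y = n - i})" for n
    by auto
  have fin: "finite {x \<in> S. f x = i}" "finite {y \<in> T. g y = i}" for i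
    using assms by (auto simp: finite_fibres_def)
  show "finite_fibres (S \<times> T) (\<lambda>(x, y). f x + g y)"
    unfolding finite_fibres_def eq by (auto intro!: fin)
  have "card {v \<in> S \<times> T. (\<lambda>(x, y). f x + g y) v = n} =
    (\<Sum>i=0..n. card {x \<in> S. f x = i} * card {y \<in> T. g y = n - i})" for n
    unfolding eq by (subst card_UN_disjoint) (auto simp: fin card_cartesian_product)
  moreover have "e ^ n = e ^ i * e ^ (n - i)" if "i \<in> {0..n}" for i n
    using that by (simp flip: power_add)
  ultimately show "gen_fps e (S \<times> T) (\<lambda>(x, y). f x + g y) = gen_fps e S f * gen_fps e T g"
    unfolding fps_eq_iff fps_mult_nth gen_fps_nth of_nat_sum of_nat_mult sum_distrib_left
    by (intro allI, simp only: of_nat_sum of_nat_mult sum_distrib_left, intro sum.cong refl)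
       (simp only: mult_ac)
qed

lemma gen_fps_bij:
  assumes "bij_betw h S T" "\<And>x. x \<in> S \<Longrightarrow> g (h x) = f x"
  shows "gen_fps e S f = gen_fps e T g"
proof -
  have "bij_betw h {x \<in> S. f x = n} {y \<in> T. g y = n}" for n
    by (rule bij_betw_subset[OF assms(1)]) (use assms in \<open>auto simp: bij_betw_def\<close>)
  hence "card {x \<in> S. f x = n} = card {y \<in> T. g y = n}" for n by (rule bij_betw_same_card)
  thus ?thesis by (simp add: fps_eq_iff)
qed

lemma gen_fps_Un:
  assumes "finite_fibres (S \<union> T) f" "S \<inter> T = {}"
  shows "gen_fps e (S \<union> T) f = gen_fps e S f + gen_fps e T f"
proof -
  have "card {x \<in> S \<union> T. f x = n} = card {x \<in> S. f x = n} + card {x \<in> T. f x = n}" for n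
  proof -
    have "{x \<in> S \<union> T. f x = n} = {x \<in> S. f x = n} \<union> {x \<in> T. f x = n}" by auto
    moreover have "finite {x \<in> S \<union> T. f x = n}" using assms(1) by (auto simp: finite_fibres_def)
    ultimately show ?thesis using assms(2) by (subst card_Un_disjoint[symmetric]) auto
  qed
  thus ?thesis by (simp add: fps_eq_iff algebra_simps)
qed

lemma gen_fps_Suc: "gen_fps e S (\<lambda>x. Suc (f x)) = fps_const e * fps_X * gen_fps e S f"
proof (rule fps_ext)
  fix n show "gen_fps e S (\<lambda>x. Suc (f x)) $ n = (fps_const e * fps_X * gen_fps e S f) $ n"
    by (cases n) (simp_all add: mult.assoc)
qed

text \<open>At exponent k m the left side carries e^(k m), the right side e^m. The condition on
  \<open>e\<close> holds for 1, and for -1 with k odd, which covers phi(-q^3).\<close>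

lemma gen_fps_scale:
  assumes "k > 0" "e ^ k = e"
  shows "gen_fps e S (\<lambda>x. k * f x) = gen_fps e S f oo fps_X ^ k"
proof (rule fps_ext)
  fix n
  show "gen_fps e S (\<lambda>x. k * f x) $ n = (gen_fps e S f oo fps_X ^ k) $ n"
  proof (cases "k dvd n")
    case True
    then obtain m where "n = k * m" by blast
    thus ?thesis using assms by (simp add: fps_nth_compose_X_power power_mult)
  next
    case False
    hence "{x \<in> S. k * f x = n} = {}" by auto
    thus ?thesis using False by (simp only: gen_fps_nth fps_nth_compose_X_power) simp
  qed
qed

section \<open>Triangular numbers and their theta series\<close>

definition tri :: "int \<Rightarrow> nat" where "tri x = nat (x * (x - 1) div 2)"

lemma two_tri: "2 * int (tri x) = x * (x - 1)"
  using tri_nonneg[of x] by (simp add: tri_def even_mult_iff)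

lemma tri_eqI: "2 * int n = x * (x - 1) \<Longrightarrow> tri x = n"
  using two_tri[of x] by simp

lemma finite_fibres_tri: "finite_fibres S tri"
proof (rule finite_fibres_int)
  fix x show "\<bar>x\<bar> \<le> int (tri x) + 1"
    using tri_bound[of x "int (tri x)"] tri_nonneg[of x] by (auto simp: tri_def abs_le_iff)
qed

text \<open>
  Each triangular number is taken twice as \<open>x\<close> runs through the integers, so \<open>theta e k\<close> is
  \<open>2 \<psi>((e q)^k)\<close>.
\<close>

definition theta :: "'a::comm_ring_1 \<Rightarrow> nat \<Rightarrow> 'a fps" where
  "theta e k = gen_fps e UNIV (\<lambda>x. k * tri x)"

subsection \<open>Sums of four triangular numbers\<close>

lemma sum_int_factorisations:
  fixes N :: nat
  assumes "N > 0"
  shows "(\<Sum>(d, e) | 0 < d \<and> 0 < e \<and> d * e = int N. d) = int (divisor_sigma N)"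
proof -
  have "(\<Sum>(d, e) | 0 < d \<and> 0 < e \<and> d * e = int N. d) = (\<Sum>d | d dvd N. int d)"
  proof (rule sum.reindex_bij_witness[of _ "\<lambda>d. (int d, int (N div d))" "\<lambda>(d, e). nat d"])
    fix v :: "int \<times> int" assume v: "v \<in> {(d, e). 0 < d \<and> 0 < e \<and> d * e = int N}"
    obtain d e where [simp]: "v = (d, e)" by (cases v)
    have *: "0 < d" "0 < e" "d * e = int N" using v by auto
    hence N: "N = nat d * nat e" by (metis nat_int nat_mult_distrib less_imp_le)
    show "(case v of (d, e) \<Rightarrow> nat d) \<in> {d. d dvd N}" using N by simp
    show "(int (case v of (d, e) \<Rightarrow> nat d), int (N div (case v of (d, e) \<Rightarrow> nat d))) = v"
      using * N by simp
    show "int (case v of (d, e) \<Rightarrow> nat d) = (case v of (d, e) \<Rightarrow> d)" using * by simp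
  next
    fix d assume "d \<in> {d. d dvd N}"
    then obtain e where N: "N = d * e" by auto
    thus "(int d, int (N div d)) \<in> {(d, e). 0 < d \<and> 0 < e \<and> d * e = int N}"
      using assms by auto
  qed auto
  thus ?thesis by (simp add: divisor_sigma_def)
qed

text \<open>Groups the triples of \<open>sum_liouville_set\<close> by j = \<open>tri x\<close>: then
  (2x - 1)^2 = 8j + 1 and d e = 2(n - j) + 1, so the weight becomes d times 2(n - 5j), and d summed
  over the factorisations gives the divisor sum.\<close>

lemma sum_tri_sigma:
  "(\<Sum>j=0..n. (int n - 5 * int j) * int (card {x. tri x = j}) * int (divisor_sigma (2 * (n - j) + 1))) = 0"
proof -
  define X where "X = {x. tri x \<le> n}"
  define D where "D = (\<lambda>x. {(d::int, e::int). 0 < d \<and> 0 < e \<and> d * e = int (2 * (n - tri x) + 1)})"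
  define c where "c = (\<lambda>j. 2 * (int n - 5 * int j) * int (divisor_sigma (2 * (n - j) + 1)))"
  have finX: "finite X"
  proof -
    have "X = (\<Union>j\<le>n. {x \<in> UNIV. tri x = j})" by (auto simp: X_def)
    thus ?thesis using finite_fibres_tri[of UNIV] by (auto simp: finite_fibres_def)
  qed
  have S: "liouville_set n = (SIGMA x:X. D x)"
  proof (intro set_eqI iffI)
    fix v assume v: "v \<in> liouville_set n"
    obtain x d e where [simp]: "v = (x, d, e)" by (cases v)
    have *: "0 < d" "0 < e" "2 * int (tri x) + d * e = 2 * int n + 1"
      using v by (auto simp: liouville_set_def two_tri)
    have "d * e > 0" using * by simp
    with * have "tri x \<le> n" by linarith
    with * show "v \<in> (SIGMA x:X. D x)" by (auto simp: X_def D_def)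
  next
    fix v assume "v \<in> (SIGMA x:X. D x)"
    thus "v \<in> liouville_set n" by (auto simp: X_def D_def liouville_set_def two_tri[symmetric])
  qed
  have finD: "finite (D x)" if "x \<in> X" for x
  proof -
    have "inj_on (Pair x) (D x)" by (auto intro: inj_onI)
    moreover have "Pair x ` D x \<subseteq> liouville_set n" using that by (auto simp: S)
    ultimately show ?thesis using finite_liouville_set by (meson finite_imageD finite_subset)
  qed
  have "0 = (\<Sum>(x, d, e)\<in>liouville_set n. d * (d * e - (2 * x - 1)\<^sup>2))"
    by (simp add: sum_liouville_set)
  also have "\<dots> = (\<Sum>x\<in>X. \<Sum>(d, e)\<in>D x. d * (d * e - (2 * x - 1)\<^sup>2))"
    unfolding S using finX finD by (subst sum.Sigma) (auto simp: case_prod_unfold)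
  also have "\<dots> = (\<Sum>x\<in>X. c (tri x))"
  proof (intro sum.cong refl)
    fix x assume x: "x \<in> X"
    have "(2 * x - 1)\<^sup>2 = 8 * int (tri x) + 1"
      using two_tri[of x] by (simp add: power2_eq_square algebra_simps)
    hence "(\<Sum>(d, e)\<in>D x. d * (d * e - (2 * x - 1)\<^sup>2)) = (\<Sum>(d, e)\<in>D x. d * (2 * (int n - 5 * int (tri x))))"
      using x by (intro sum.cong) (auto simp: D_def X_def)
    also have "\<dots> = c (tri x)"
      using sum_int_factorisations[of "2 * (n - tri x) + 1"]
      by (simp add: D_def c_def case_prod_unfold mult_ac flip: sum_distrib_left sum_distrib_right)
    finally show "(\<Sum>(d, e)\<in>D x. d * (d * e - (2 * x - 1)\<^sup>2)) = c (tri x)" .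
  qed
  also have "\<dots> = (\<Sum>j\<in>{0..n}. \<Sum>x | x \<in> X \<and> tri x = j. c (tri x))"
    by (rule sum.group[symmetric]) (use finX in \<open>auto simp: X_def\<close>)
  also have "\<dots> = (\<Sum>j\<in>{0..n}. int (card {x. tri x = j}) * c j)"
  proof (intro sum.cong refl)
    fix j assume "j \<in> {0..n}"
    hence "{x. x \<in> X \<and> tri x = j} = {x. tri x = j}" by (auto simp: X_def)
    thus "(\<Sum>x | x \<in> X \<and> tri x = j. c (tri x)) = int (card {x. tri x = j}) * c j" by simp
  qed
  also have "\<dots> = 2 * (\<Sum>j=0..n. (int n - 5 * int j) * int (card {x. tri x = j}) * int (divisor_sigma (2 * (n - j) + 1)))"
    unfolding sum_distrib_left by (intro sum.cong) (auto simp: c_def)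
  finally show ?thesis by simp
qed

lemma theta_nth_0 [simp]: "k > 0 \<Longrightarrow> theta e k $ 0 = 2"
proof -
  assume "k > 0"
  hence "{x. k * tri x = 0} = {0, 1}" using two_tri by (auto simp: tri_def) (smt (verit) two_tri mult_eq_0_iff of_nat_0)
  thus ?thesis by (simp add: theta_def)
qed

text \<open>With T = \<open>theta 1 1\<close> and E = q d/dq, the coefficients of T E(T^4) = 4 E(T)
  T^4 give the recurrence that \<open>sum_tri_sigma\<close> provides for the divisor sums. For m > 0
  it determines the m-th coefficient, whose factor is m T_0 = 2m; both sequences start with 2^4 =
  16.\<close>

theorem theta_pow4_nth:
  "(theta 1 1 :: 'a::{idom,ring_char_0} fps) ^ 4 $ n = 16 * of_nat (divisor_sigma (2 * n + 1))"
proof -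
  define T where "T = (theta 1 1 :: 'a fps)"
  define G where "G = Abs_fps (\<lambda>n. 16 * of_nat (divisor_sigma (2 * n + 1)) :: 'a)"
  define E where "E = (\<lambda>H::'a fps. fps_X * fps_deriv H)"
  have E: "E H $ j = of_nat j * H $ j" for H j
    by (cases j) (simp_all add: E_def)
  have "fps_deriv (T ^ 4) = 4 * fps_deriv T * T ^ 3" by (simp add: fps_deriv_power)
  hence "T * E (T ^ 4) = 4 * (E T * T ^ 4)"
    by (simp add: E_def power4_eq_xxxx power3_eq_cube mult_ac)
  hence "T * E (T ^ 4) = fps_const 4 * (E T * T ^ 4)" by (simp only: numeral_fps_const)
  hence "(T * E (T ^ 4)) $ m - (fps_const 4 * (E T * T ^ 4)) $ m = 0" for m
    by simp
  hence "(\<Sum>j=0..m. T $ j * (of_nat (m - j) * T ^ 4 $ (m - j))) -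
         4 * (\<Sum>j=0..m. of_nat j * T $ j * T ^ 4 $ (m - j)) = 0" for m
    by (simp only: fps_mult_nth[of T] fps_mult_nth[of "E T"] E fps_mult_left_const_nth)
  hence F: "(\<Sum>j=0..m. (of_nat m - 5 * of_nat j) * T $ j * T ^ 4 $ (m - j)) = 0" for m
    by (simp add: sum_distrib_left sum_subtractf[symmetric] of_nat_diff algebra_simps)
  have G: "(\<Sum>j=0..m. (of_nat m - 5 * of_nat j) * T $ j * G $ (m - j)) = 0" for m
  proof -
    have "(\<Sum>j=0..m. (of_nat m - 5 * of_nat j) * T $ j * G $ (m - j)) =
      16 * of_int (\<Sum>j=0..m. (int m - 5 * int j) * int (card {x. tri x = j}) * int (divisor_sigma (2 * (m - j) + 1)))"
      by (simp add: T_def theta_def G_def sum_distrib_left mult_ac)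
    thus ?thesis by (simp only: sum_tri_sigma) simp
  qed
  have "T ^ 4 $ n = G $ n"
  proof (induction n rule: less_induct)
    case (less m)
    show ?case
    proof (cases "m = 0")
      case True
      have "{d. d dvd Suc 0} = {1}" by auto
      with True show ?thesis
        by (simp add: T_def G_def fps_nth_power_0 divisor_sigma_def)
    next
      case False
      have "0 = (\<Sum>j=0..m. (of_nat m - 5 * of_nat j) * T $ j * (T ^ 4 $ (m - j) - G $ (m - j)))"
        using F[of m] G[of m] by (simp add: right_diff_distrib sum_subtractf)
      also have "\<dots> = (\<Sum>j\<in>{0}. (of_nat m - 5 * of_nat j) * T $ j * (T ^ 4 $ (m - j) - G $ (m - j)))"
        by (rule sum.mono_neutral_right) (use less False in auto)
      also have "\<dots> = of_nat m * 2 * (T ^ 4 $ m - G $ m)" by (simp add: T_def)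
      finally show ?thesis using False by simp
    qed
  qed
  thus ?thesis by (simp add: T_def G_def)
qed

subsection \<open>The hexagonal lattice\<close>

lemma finite_fibres_bij:
  assumes "bij_betw h S T" "\<And>x. x \<in> S \<Longrightarrow> g (h x) = f x" "finite_fibres S f"
  shows "finite_fibres T g"
  unfolding finite_fibres_def
proof
  fix n
  have "{y \<in> T. g y = n} = h ` {x \<in> S. f x = n}"
    using assms(1,2) by (auto simp: bij_betw_def)
  thus "finite {y \<in> T. g y = n}" using assms(3) by (auto simp: finite_fibres_def)
qed

lemma gen_fps_range: "inj h \<Longrightarrow> gen_fps e (range h) f = gen_fps e UNIV (\<lambda>x. f (h x))"
  by (rule gen_fps_bij[of h, symmetric]) (auto simp: bij_betw_def)

lemma gen_fps_bij_UNIV: "bij h \<Longrightarrow> gen_fps e UNIV (\<lambda>x. f (h x)) = gen_fps e UNIV f"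
  by (rule gen_fps_bij[of h]) auto

lemma finite_fibres_theta: "k > 0 \<Longrightarrow> finite_fibres S (\<lambda>x. k * tri x)"
  by (intro finite_fibres_scale finite_fibres_tri)

lemma tri_minus: "tri (1 - x) = tri x"
  by (rule tri_eqI) (use two_tri[of x] in \<open>simp add: algebra_simps\<close>)

section \<open>Pentagonal numbers and the 3-dissection of theta\<close>

definition pent :: "int \<Rightarrow> nat" where "pent m = nat (m * (3 * m - 1) div 2)"

lemma two_pent: "2 * int (pent m) = m * (3 * m - 1)"
proof -
  have "0 \<le> m * (3 * m - 1)"
    by (cases "m \<le> 0") (auto intro: mult_nonpos_nonpos mult_nonneg_nonneg)
  moreover have "even (m * (3 * m - 1))" by simp
  ultimately show ?thesis unfolding pent_def by auto
qed

lemma finite_fibres_pent: "finite_fibres S pent"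
proof (rule finite_fibres_int)
  fix x :: int
  have "0 \<le> (x - 1) * (3 * x - 2)"
    by (cases "x \<le> 0") (auto intro: mult_nonpos_nonpos mult_nonneg_nonneg)
  moreover have "0 \<le> x * (3 * x + 1)"
    by (cases "x < 0") (auto intro: mult_nonpos_nonpos mult_nonneg_nonneg)
  ultimately show "\<bar>x\<bar> \<le> int (pent x) + 1"
    using two_pent[of x] by (simp add: algebra_simps abs_le_iff)
qed

lemma tri_mod_3:
  "tri (3 * m) = 3 * pent m" "tri (3 * m + 1) = 3 * pent (- m)" "tri (3 * m - 1) = Suc (9 * tri m)"
  by (rule tri_eqI, use two_pent[of m] two_pent[of "- m"] two_tri[of m] in \<open>simp add: algebra_simps\<close>)+

definition pent_fps :: "'a::comm_ring_1 fps" where "pent_fps = gen_fps 1 UNIV pent"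

text \<open>The classes 0 and 1 modulo 3 both contribute exponents 3 \<open>pent\<close>, the class
  -1 contributes 1 + 9 \<open>tri\<close>. Compositions with X^3 keep the residues of the exponents
  visible.\<close>

lemma theta_dissect_3:
  "(theta 1 1 :: 'a::idom fps) = 2 * (pent_fps oo fps_X ^ 3) + fps_X * (theta 1 3 oo fps_X ^ 3)"
proof -
  let ?A = "range (\<lambda>m::int. 3 * m)" and ?B = "range (\<lambda>m::int. 3 * m + 1)" and ?C = "range (\<lambda>m::int. 3 * m - 1)"
  have U: "UNIV = ?A \<union> (?B \<union> ?C)"
  proof (intro set_eqI iffI)
    fix x :: int
    have "x = 3 * (x div 3) \<or> x = 3 * (x div 3) + 1 \<or> x = 3 * (x div 3 + 1) - 1" by presburger
    thus "x \<in> ?A \<union> (?B \<union> ?C)" by blast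
  qed auto
  have "?A \<inter> (?B \<union> ?C) = {}" "?B \<inter> ?C = {}" by (auto, presburger+)
  hence "(theta 1 1 :: 'a fps) = gen_fps 1 ?A tri + (gen_fps 1 ?B tri + gen_fps 1 ?C tri)"
    unfolding theta_def mult_1_left by (subst U) (simp add: gen_fps_Un finite_fibres_tri)
  also have "gen_fps 1 ?A tri = (pent_fps oo fps_X ^ 3 :: 'a fps)"
    by (subst gen_fps_range) (auto intro: injI simp: tri_mod_3 pent_fps_def gen_fps_scale)
  also have "gen_fps 1 ?B tri = (pent_fps oo fps_X ^ 3 :: 'a fps)"
  proof -
    have "gen_fps 1 ?B tri = (gen_fps 1 UNIV (\<lambda>m. 3 * pent (- m)) :: 'a fps)"
      by (subst gen_fps_range) (auto intro: injI simp: tri_mod_3)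
    also have "\<dots> = gen_fps 1 UNIV (\<lambda>m. 3 * pent m)"
      using bij_uminus[where 'a=int] by (rule gen_fps_bij_UNIV[of uminus 1 "\<lambda>m. 3 * pent m"])
    finally show ?thesis by (simp add: pent_fps_def gen_fps_scale)
  qed
  also have "gen_fps 1 ?C tri = (fps_X * (theta 1 3 oo fps_X ^ 3) :: 'a fps)"
  proof -
    have "gen_fps 1 ?C tri = (gen_fps 1 UNIV (\<lambda>m. Suc (3 * (3 * tri m))) :: 'a fps)"
      by (subst gen_fps_range) (auto intro: injI simp: tri_mod_3)
    also have "\<dots> = fps_const 1 * fps_X * (gen_fps 1 UNIV (\<lambda>m. 3 * tri m) oo fps_X ^ 3)"
      unfolding gen_fps_Suc by (subst gen_fps_scale) auto
    finally show ?thesis by (simp add: theta_def)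
  qed
  finally show ?thesis by simp
qed

section \<open>The hexagonal form and its theta series\<close>

definition hexa :: "int \<times> int \<Rightarrow> nat" where "hexa = (\<lambda>(x, y). nat (x\<^sup>2 + x * y + y\<^sup>2))"

lemma two_hexa: "2 * (x\<^sup>2 + x * y + y\<^sup>2) = x\<^sup>2 + y\<^sup>2 + (x + y)\<^sup>2" for x y :: int
  by (simp add: power2_eq_square algebra_simps)

lemma int_hexa: "int (hexa (x, y)) = x\<^sup>2 + x * y + y\<^sup>2"
proof -
  have "0 \<le> 2 * (x\<^sup>2 + x * y + y\<^sup>2)" unfolding two_hexa by simp
  thus ?thesis by (simp add: hexa_def)
qed

lemma abs_le_square_int: "\<bar>x\<bar> \<le> x\<^sup>2" for x :: int
proof (cases "x = 0")
  case False
  hence "1 * \<bar>x\<bar> \<le> \<bar>x\<bar> * \<bar>x\<bar>" by (intro mult_right_mono) auto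
  thus ?thesis by (simp add: power2_eq_square)
qed simp

lemma finite_fibres_hexa: "finite_fibres S hexa"
  unfolding finite_fibres_def
proof
  fix n
  have "{v \<in> S. hexa v = n} \<subseteq> {- 2 * int n..2 * int n} \<times> {- 2 * int n..2 * int n}"
  proof
    fix v assume v: "v \<in> {v \<in> S. hexa v = n}"
    obtain x y where [simp]: "v = (x, y)" by (cases v)
    have "2 * int n = x\<^sup>2 + y\<^sup>2 + (x + y)\<^sup>2" using v int_hexa[of x y] two_hexa[of x y] by simp
    moreover have "0 \<le> x\<^sup>2" "0 \<le> y\<^sup>2" "0 \<le> (x + y)\<^sup>2" by simp_all
    ultimately have "\<bar>x\<bar> \<le> 2 * int n" "\<bar>y\<bar> \<le> 2 * int n"
      using abs_le_square_int[of x] abs_le_square_int[of y] by linarith+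
    thus "v \<in> {- 2 * int n..2 * int n} \<times> {- 2 * int n..2 * int n}" by auto
  qed
  thus "finite {v \<in> S. hexa v = n}" by (rule finite_subset) simp
qed

definition hexa_fps :: "'a::comm_ring_1 fps" where "hexa_fps = gen_fps 1 UNIV hexa"

text \<open>
  Triples of integers congruent modulo 3 decompose into their mean \<open>s\<close> and a hexagonal lattice
  vector; sorting the triples by residue class gives the right-hand side.
\<close>

lemma hexa_theta:
  "(hexa_fps * theta 1 1 :: 'a::comm_ring_1 fps) = 2 * pent_fps ^ 3 + fps_X * theta 1 3 ^ 3"
proof -
  define C where "C = {(x, y, z). (3::int) dvd x - y \<and> 3 dvd x - z}"
  \<comment> \<open>The offsets from s in \<open>h\<close> sum to 0 and their squares to 6 (u^2 + u
    v + v^2), so the three triangular numbers add up to 3 (hexa + tri s). Hence the division in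
    \<open>g\<close> is exact on \<open>C\<close>.\<close>
  define g where "g = (\<lambda>(x, y, z). (tri x + tri y + tri z) div 3)"
  define h where "h = (\<lambda>((u::int, v::int), s::int). (s + u - v, s + u + 2 * v, s - 2 * u - v))"
  define R where "R = (\<lambda>r::int. range (\<lambda>(a::int, b::int, c::int). (3 * a + r, 3 * b + r, 3 * c + r)))"
  have bij: "bij_betw h (UNIV \<times> UNIV) C"
  proof (rule bij_betw_byWitness[of _ "\<lambda>(x, y, z). (((x - z) div 3, (y - x) div 3), (x + y + z) div 3)"])
    show "\<forall>v\<in>C. h (case v of (x, y, z) \<Rightarrow> (((x - z) div 3, (y - x) div 3), (x + y + z) div 3)) = v"
    proof
      fix v assume v: "v \<in> C"
      obtain x y z where [simp]: "v = (x, y, z)" by (cases v)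
      obtain b c where "x - y = 3 * b" "x - z = 3 * c" using v by (auto simp: C_def elim!: dvdE)
      hence yz: "y = x - 3 * b" "z = x - 3 * c" by simp_all
      have "(x - z) div 3 = c" "(y - x) div 3 = - b" "(x + y + z) div 3 = x - b - c"
        unfolding yz by presburger+
      thus "h (case v of (x, y, z) \<Rightarrow> (((x - z) div 3, (y - x) div 3), (x + y + z) div 3)) = v"
        by (simp add: h_def yz)
    qed
    show "h ` (UNIV \<times> UNIV) \<subseteq> C"
      by (auto simp: h_def C_def)
  qed (auto simp: h_def)
  have gh: "g (h v) = (\<lambda>(w, s). hexa w + tri s) v" for v
  proof -
    obtain u w s where v: "v = ((u, w), s)" by (metis prod.exhaust)
    have "2 * int (tri (s + u - w) + tri (s + u + 2 * w) + tri (s - 2 * u - w)) =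
          2 * int (3 * (hexa (u, w) + tri s))"
      unfolding of_nat_add of_nat_mult distrib_left two_tri int_hexa
      using two_tri[of s] by (simp add: power2_eq_square algebra_simps)
    hence "tri (s + u - w) + tri (s + u + 2 * w) + tri (s - 2 * u - w) = 3 * (hexa (u, w) + tri s)"
      by (simp only: mult_cancel_left of_nat_eq_iff) simp
    thus ?thesis by (simp add: v g_def h_def)
  qed
  have ft: "finite_fibres UNIV (\<lambda>x. tri x)" by (rule finite_fibres_tri)
  have fin: "finite_fibres C g"
    by (rule finite_fibres_bij[OF bij, of g "\<lambda>(w, s). hexa w + tri s"])
       (simp_all only: gh finite_fibres_times[OF finite_fibres_hexa ft])
  have "(hexa_fps * theta 1 1 :: 'a fps) = gen_fps 1 C g"
    unfolding hexa_fps_def theta_def mult_1_left gen_fps_times[OF finite_fibres_hexa ft, symmetric]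
    by (rule gen_fps_bij[OF bij, of g "\<lambda>(w, s). hexa w + tri s"]) (simp only: gh)
  also have "C = R 0 \<union> (R 1 \<union> R (- 1))"
  proof (intro set_eqI iffI)
    fix v assume v: "v \<in> C"
    obtain x y z where [simp]: "v = (x, y, z)" by (cases v)
    obtain b c where b: "x - y = 3 * b" "x - z = 3 * c" using v by (auto simp: C_def elim!: dvdE)
    define r where "r = (x + 1) mod 3 - 1"
    define a where "a = (x + 1) div 3"
    have "r = 0 \<or> r = 1 \<or> r = - 1" unfolding r_def by presburger
    moreover have "x = 3 * a + r" unfolding r_def a_def by presburger
    ultimately have r: "r \<in> {0, 1, -1}" "x = 3 * a + r" by auto
    have "v = (\<lambda>(a, b, c). (3 * a + r, 3 * b + r, 3 * c + r)) (a, a - b, a - c)"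
      using r b by simp
    hence "v \<in> R r" unfolding R_def by (rule range_eqI)
    with r(1) show "v \<in> R 0 \<union> (R 1 \<union> R (- 1))" by auto
  next
    fix v assume "v \<in> R 0 \<union> (R 1 \<union> R (- 1))"
    thus "v \<in> C" by (auto simp: R_def C_def)
  qed
  also have "gen_fps 1 (R 0 \<union> (R 1 \<union> R (- 1))) g = (gen_fps 1 (R 0) g + (gen_fps 1 (R 1) g + gen_fps 1 (R (- 1)) g) :: 'a fps)"
  proof -
    have "fst v mod 3 = r mod 3" if "v \<in> R r" for v r
      using that by (auto simp: R_def)
    hence disj: "R r \<inter> R s = {}" if "r mod 3 \<noteq> s mod 3" for r s
      using that by (metis disjoint_iff)
    have "R 0 \<inter> (R 1 \<union> R (- 1)) = {}" "R 1 \<inter> R (- 1) = {}"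
      using disj[of 0 1] disj[of 0 "- 1"] disj[of 1 "- 1"] by auto
    moreover have "finite_fibres (R 0 \<union> (R 1 \<union> R (- 1))) g" "finite_fibres (R 1 \<union> R (- 1)) g"
      by (rule finite_fibres_subset[OF fin]; auto simp: R_def C_def)+
    ultimately show ?thesis by (simp add: gen_fps_Un)
  qed
  finally have sum: "(hexa_fps * theta 1 1 :: 'a fps) = gen_fps 1 (R 0) g + (gen_fps 1 (R 1) g + gen_fps 1 (R (- 1)) g)" .
  have R: "gen_fps 1 (R r) g = (gen_fps 1 UNIV (\<lambda>(a, b, c). (tri (3 * a + r) + tri (3 * b + r) + tri (3 * c + r)) div 3) :: 'a fps)" for r
    unfolding R_def by (subst gen_fps_range) (auto intro: injI simp: g_def case_prod_unfold)
  have cube: "gen_fps 1 UNIV (\<lambda>(a, b, c). f a + (f b + f c)) = (gen_fps 1 UNIV f ^ 3 :: 'a fps)"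
    if "finite_fibres UNIV f" for f :: "int \<Rightarrow> nat"
    using gen_fps_times[OF that finite_fibres_times[OF that that], where e = "1::'a"] gen_fps_times[OF that that, where e = "1::'a"]
    by (simp add: case_prod_unfold power3_eq_cube mult.assoc)
  have "gen_fps 1 (R 0) g = (pent_fps ^ 3 :: 'a fps)"
    unfolding R cube[OF finite_fibres_pent, symmetric] pent_fps_def
    by (simp add: tri_mod_3 distrib_left[symmetric] add.assoc del: distrib_left_numeral)
  moreover have "gen_fps 1 (R 1) g = (pent_fps ^ 3 :: 'a fps)"
  proof -
    have *: "bij (\<lambda>(a::int, b::int, c::int). (- a, - b, - c))"
      by (rule bij_betw_byWitness[of _ "\<lambda>(a::int, b::int, c::int). (- a, - b, - c)"]) auto
    have "gen_fps 1 (R 1) g = (gen_fps 1 UNIV (\<lambda>v. (\<lambda>(a, b, c). pent a + (pent b + pent c))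
        ((\<lambda>(a, b, c). (- a, - b, - c)) v)) :: 'a fps)"
      unfolding R
      by (simp add: tri_mod_3 distrib_left[symmetric] add.assoc case_prod_unfold del: distrib_left_numeral)
    also have "\<dots> = gen_fps 1 UNIV (\<lambda>(a, b, c). pent a + (pent b + pent c))"
      by (rule gen_fps_bij_UNIV[OF *])
    also have "\<dots> = pent_fps ^ 3" unfolding cube[OF finite_fibres_pent] pent_fps_def ..
    finally show ?thesis .
  qed
  moreover have "gen_fps 1 (R (- 1)) g = (fps_X * theta 1 3 ^ 3 :: 'a fps)"
  proof -
    \<comment> \<open>Each of the three triangular numbers is 1 + 9 tri; after division by 3 the
      three ones leave the single factor X.\<close>
    have "(tri (3 * a - 1) + tri (3 * b - 1) + tri (3 * c - 1)) div 3 = Suc (3 * tri a + (3 * tri b + 3 * tri c))" for a b c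
      unfolding tri_mod_3 by simp
    hence "gen_fps 1 (R (- 1)) g = (gen_fps 1 UNIV (\<lambda>v. Suc ((\<lambda>(a, b, c). 3 * tri a + (3 * tri b + 3 * tri c)) v)) :: 'a fps)"
      unfolding R by (simp add: case_prod_unfold)
    thus ?thesis by (simp only: gen_fps_Suc theta_def cube[OF finite_fibres_theta]) simp
  qed
  ultimately show ?thesis unfolding sum by simp
qed

subsection \<open>The Hecke relation at 3\<close>

definition sigma_third :: "nat \<Rightarrow> nat" where
  "sigma_third N = (if 3 dvd N then divisor_sigma (N div 3) else 0)"

text \<open>A divisor of 3^(b+1) m either carries the full power of 3, and is then 3^(b+1) times a
  divisor of m, or already divides 3^b m.\<close>

lemma divisor_sigma_pow3_Suc:
  fixes m b :: nat
  assumes "\<not> 3 dvd m"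
  shows "divisor_sigma (3 ^ Suc b * m) = divisor_sigma (3 ^ b * m) + 3 ^ Suc b * divisor_sigma m"
proof -
  let ?D = "\<lambda>m::nat. {d. d dvd m}"
  have m: "m > 0" using assms by (cases m) auto
  have "?D (3 ^ Suc b * m) = ?D (3 ^ b * m) \<union> (*) (3 ^ Suc b) ` ?D m"
  proof (intro set_eqI iffI)
    fix d assume d: "d \<in> ?D (3 ^ Suc b * m)"
    show "d \<in> ?D (3 ^ b * m) \<union> (*) (3 ^ Suc b) ` ?D m"
    proof (cases "3 ^ Suc b dvd d")
      case True
      then obtain k where k: "d = 3 ^ Suc b * k" by blast
      with d have "k dvd m" by (simp del: power_Suc)
      thus ?thesis using k by blast
    next
      case False
      have "d \<noteq> 0" using False by (metis dvd_0_right)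
      then obtain k where k: "d = 3 ^ multiplicity 3 d * k" "\<not> 3 dvd k"
        using multiplicity_decompose'[of d 3] by auto
      have "multiplicity 3 d \<le> b"
        using False multiplicity_dvd'[of "Suc b" 3 d] by (meson not_less_eq_eq)
      moreover have "k dvd m"
      proof -
        have "coprime (3::nat) k" using k(2) by (intro prime_imp_coprime) auto
        hence "coprime k (3 ^ Suc b)" by (simp add: coprime_commute)
        moreover have "k dvd 3 ^ Suc b * m" using d k(1) by (metis dvd_mult_right mem_Collect_eq)
        ultimately show ?thesis by (simp add: coprime_dvd_mult_right_iff del: power_Suc)
      qed
      ultimately have "d dvd 3 ^ b * m"
        by (subst k(1)) (intro mult_dvd_mono le_imp_power_dvd)
      thus ?thesis by simp
    qed
  next
    fix d assume "d \<in> ?D (3 ^ b * m) \<union> (*) (3 ^ Suc b) ` ?D m"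
    thus "d \<in> ?D (3 ^ Suc b * m)" by (auto simp: mult.assoc intro: dvd_mult)
  qed
  moreover have "?D (3 ^ b * m) \<inter> (*) (3 ^ Suc b) ` ?D m = {}"
    using assms by (auto simp: mult.assoc mult.left_commute[of 3] dest: dvd_mult_left)
  moreover have "finite (?D (3 ^ b * m))" "finite (?D m)" using m by (auto intro: finite_divisors_nat)
  ultimately have "divisor_sigma (3 ^ Suc b * m) = divisor_sigma (3 ^ b * m) + \<Sum> ((*) (3 ^ Suc b) ` ?D m)"
    unfolding divisor_sigma_def by (simp add: sum.union_disjoint)
  also have "\<Sum> ((*) (3 ^ Suc b) ` ?D m) = 3 ^ Suc b * divisor_sigma m"
    unfolding divisor_sigma_def sum_distrib_left by (subst sum.reindex) (auto intro: inj_onI)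
  finally show ?thesis .
qed

text \<open>The geometric sum sigma(3^b) = (3^(b+1) - 1) / 2, cleared of subtraction and division to
  stay in the naturals.\<close>

lemma divisor_sigma_pow3:
  fixes m b :: nat
  assumes "\<not> 3 dvd m"
  shows "2 * divisor_sigma (3 ^ b * m) + divisor_sigma m = 3 ^ Suc b * divisor_sigma m"
proof (induction b)
  case (Suc b)
  thus ?case unfolding divisor_sigma_pow3_Suc[OF assms] by simp
qed simp

lemma sigma_third_pow3:
  fixes m b :: nat
  assumes "\<not> 3 dvd m"
  shows "2 * sigma_third (3 ^ b * m) + divisor_sigma m = 3 ^ b * divisor_sigma m"
proof (cases b)
  case 0
  thus ?thesis using assms by (simp add: sigma_third_def)
next
  case (Suc c)
  thus ?thesis using divisor_sigma_pow3[OF assms, of c] by (simp add: sigma_third_def)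
qed

text \<open>With N = 3^b m, twice each divisor sum is a multiple of sigma(m), and (3^(b+2) - 1) + 3
  (3^b - 1) = 4 (3^(b+1) - 1).\<close>

lemma divisor_sigma_times_3:
  assumes "N > 0"
  shows "divisor_sigma (3 * N) + 3 * sigma_third N = 4 * divisor_sigma N"
proof -
  obtain m where m: "N = 3 ^ multiplicity 3 N * m" "\<not> 3 dvd m"
    using multiplicity_decompose'[of N 3] assms by auto
  define b where "b = multiplicity 3 N"
  have N: "N = 3 ^ b * m" "3 * N = 3 ^ Suc b * m" using m by (simp_all add: b_def)
  show ?thesis
    using divisor_sigma_pow3[OF m(2), of b] divisor_sigma_pow3[OF m(2), of "Suc b"]
      sigma_third_pow3[OF m(2), of b] unfolding N by (simp add: mult.assoc)
qed

section \<open>Fourth powers of theta and divisor sums at multiples of 3\<close>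

lemma theta_scale: "k > 0 \<Longrightarrow> (theta 1 k :: 'a::idom fps) = theta 1 1 oo fps_X ^ k"
  by (simp add: theta_def gen_fps_scale)

text \<open>The number 2n + 1 is divisible by 3 exactly when n = 3j + 1, and then equals 3(2j + 1);
  these n are the possible exponents of q psi(q^3)^4.\<close>

lemma theta_pow4_3_nth:
  "(fps_X * (theta 1 3 :: 'a::{idom,ring_char_0} fps) ^ 4) $ n = 16 * of_nat (sigma_third (2 * n + 1))"
proof -
  have T: "(theta 1 3 :: 'a fps) ^ 4 = theta 1 1 ^ 4 oo fps_X ^ 3"
    by (simp add: fps_compose_power theta_scale[of 3])
  show ?thesis
  proof (cases n)
    case 0
    thus ?thesis by (simp add: sigma_third_def)
  next
    case (Suc k)
    show ?thesis
    proof (cases "3 dvd k")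
      case True
      then obtain j where j: "k = 3 * j" by blast
      have "2 * n + 1 = 3 * (2 * j + 1)" using Suc j by simp
      moreover have "sigma_third (3 * M) = divisor_sigma M" for M by (simp add: sigma_third_def)
      ultimately have "sigma_third (2 * n + 1) = divisor_sigma (2 * j + 1)" by (simp only:)
      moreover have "(fps_X * (theta 1 3 :: 'a fps) ^ 4) $ n = theta 1 1 ^ 4 $ j"
        using Suc j by (simp add: T fps_nth_compose_X_power)
      ultimately show ?thesis by (simp only: theta_pow4_nth)
    next
      case False
      hence "\<not> 3 dvd 2 * n + 1" using Suc by presburger
      hence "sigma_third (2 * n + 1) = 0" by (simp add: sigma_third_def)
      moreover have "(fps_X * (theta 1 3 :: 'a fps) ^ 4) $ n = 0"
        using Suc False by (simp add: T fps_nth_compose_X_power)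
      ultimately show ?thesis by simp
    qed
  qed
qed

text \<open>
  The coefficients of the fourth power at \<open>3n + 1\<close> are computed twice: by the 3-dissection of theta,
  and by the Hecke relation for the divisor sums.
\<close>

lemma theta_pow4_pent:
  "(theta 1 1 :: 'a::{idom,ring_char_0} fps) ^ 4 = 8 * theta 1 3 * pent_fps ^ 3 + fps_X * theta 1 3 ^ 4"
proof -
  define T where "T = (theta 1 1 :: 'a fps)"
  define T3 where "T3 = (theta 1 3 :: 'a fps)"
  define A where "A = (pent_fps :: 'a fps)"
  define C where "C = (\<lambda>F::'a fps. F oo fps_X ^ 3)"
  have C: "C (F * G) = C F * C G" "C F + C G = C (F + G)" "C F ^ k = C (F ^ k)" "C fps_X = fps_X ^ 3"
    "C (numeral w) = numeral w" for F G k w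
    by (simp_all add: C_def fps_compose_mult_distrib fps_compose_add_distrib fps_compose_power numeral_fps_const fps_X_fps_compose_startby0)
  have C_nth: "C F $ (3 * j) = F $ j" "C F $ Suc (3 * j) = 0" "m mod 3 = 2 \<Longrightarrow> C F $ m = 0" for F j m
  proof -
    have "\<not> 3 dvd Suc (3 * j)" "m mod 3 = 2 \<Longrightarrow> \<not> 3 dvd m" by presburger+
    thus "C F $ (3 * j) = F $ j" "C F $ Suc (3 * j) = 0" "m mod 3 = 2 \<Longrightarrow> C F $ m = 0"
      unfolding C_def fps_nth_compose_X_power by simp_all
  qed
  have "T = 2 * C A + fps_X * C T3"
    unfolding T_def A_def T3_def C_def by (rule theta_dissect_3)
  hence "T ^ 4 = (2 * C A + fps_X * C T3) ^ 4" by simp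
  \<comment> \<open>The binomial expansion sorted by exponents modulo 3; X^3 is absorbed as
    \<open>C fps_X\<close>.\<close>
  also have "\<dots> = C (16 * A ^ 4 + 8 * fps_X * A * T3 ^ 3) + fps_X * C (32 * A ^ 3 * T3 + fps_X * T3 ^ 4)
      + fps_X ^ 2 * C (24 * A ^ 2 * T3 ^ 2)"
    unfolding C(2)[symmetric] C(1) C(3)[symmetric] C(4,5)
    by (simp add: power4_eq_xxxx power3_eq_cube power2_eq_square algebra_simps)
  finally have "T ^ 4 $ (3 * n + 1) = (32 * A ^ 3 * T3 + fps_X * T3 ^ 4) $ n" for n
  proof -
    assume T4: "T ^ 4 = C (16 * A ^ 4 + 8 * fps_X * A * T3 ^ 3) + fps_X * C (32 * A ^ 3 * T3 + fps_X * T3 ^ 4)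
      + fps_X ^ 2 * C (24 * A ^ 2 * T3 ^ 2)"
    have "3 * n + 1 < 2 \<or> (3 * n + 1 - 2) mod 3 = 2" by presburger
    hence "(fps_X ^ 2 * C (24 * A ^ 2 * T3 ^ 2)) $ (3 * n + 1) = 0"
      unfolding fps_X_power_mult_nth using C_nth(3) by auto
    moreover have "(fps_X * C F) $ (3 * n + 1) = F $ n" for F by (simp add: C_nth)
    moreover have "C F $ (3 * n + 1) = 0" for F by (simp add: C_nth)
    ultimately show ?thesis unfolding T4 by (simp only: fps_add_nth) simp
  qed
  \<comment> \<open>The index 3n + 1 belongs to the divisor sum at 3(2n + 1), where the Hecke
    relation applies.\<close>
  moreover have "3 * (2 * n + 1) = 2 * (3 * n + 1) + 1" for n :: nat by simp
  ultimately have *: "(32 * A ^ 3 * T3 + fps_X * T3 ^ 4) $ n = 16 * of_nat (divisor_sigma (3 * (2 * n + 1)))" for n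
    unfolding T_def by (simp only: theta_pow4_nth)
  have "32 * A ^ 3 * T3 + fps_X * T3 ^ 4 = fps_const 4 * T ^ 4 - fps_const 3 * (fps_X * T3 ^ 4)"
  proof (rule fps_ext)
    fix n
    have "of_nat (divisor_sigma (3 * (2 * n + 1)) + 3 * sigma_third (2 * n + 1)) = (of_nat (4 * divisor_sigma (2 * n + 1)) :: 'a)"
      by (subst divisor_sigma_times_3) auto
    hence **: "(of_nat (divisor_sigma (3 * (2 * n + 1))) :: 'a) =
        4 * of_nat (divisor_sigma (2 * n + 1)) - 3 * of_nat (sigma_third (2 * n + 1))"
      by (simp add: eq_diff_eq)
    show "(32 * A ^ 3 * T3 + fps_X * T3 ^ 4) $ n = (fps_const 4 * T ^ 4 - fps_const 3 * (fps_X * T3 ^ 4)) $ n"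
      unfolding * ** unfolding fps_sub_nth fps_mult_left_const_nth T_def T3_def theta_pow4_nth theta_pow4_3_nth
      by (simp add: algebra_simps)
  qed
  hence "4 * T ^ 4 = 4 * (8 * T3 * A ^ 3 + fps_X * T3 ^ 4)"
    by (simp add: numeral_fps_const[symmetric] algebra_simps)
  thus ?thesis unfolding T_def T3_def A_def by (subst (asm) mult_cancel_left) simp
qed

text \<open>Multiplied by 4 \<open>theta 1 3\<close>, the right side of \<open>hexa_theta\<close> is
  8 pent^3 theta_3 + 4 X theta_3^4. By \<open>theta_pow4_pent\<close> this equals theta_1^4 + 3 X
  theta_3^4, whose coefficients are known.\<close>

lemma hexa_theta_theta_nth:
  "(hexa_fps * theta 1 1 * theta 1 3 :: 'a::{idom,ring_char_0} fps) $ n =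
     4 * of_nat (divisor_sigma (2 * n + 1) + 3 * sigma_third (2 * n + 1))"
proof -
  have "fps_const 4 * (hexa_fps * theta 1 1 * theta 1 3 :: 'a fps) = theta 1 1 ^ 4 + fps_const 3 * (fps_X * theta 1 3 ^ 4)"
    unfolding hexa_theta theta_pow4_pent
    by (simp add: numeral_fps_const[symmetric] algebra_simps power4_eq_xxxx power3_eq_cube)
  hence "(fps_const 4 * (hexa_fps * theta 1 1 * theta 1 3 :: 'a fps)) $ n = (theta 1 1 ^ 4 + fps_const 3 * (fps_X * theta 1 3 ^ 4)) $ n"
    by simp
  hence "4 * (hexa_fps * theta 1 1 * theta 1 3 :: 'a fps) $ n = 4 * (4 * of_nat (divisor_sigma (2 * n + 1) + 3 * sigma_third (2 * n + 1)))"
    unfolding fps_add_nth fps_mult_left_const_nth theta_pow4_nth theta_pow4_3_nth by (simp add: algebra_simps)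
  thus ?thesis by (subst (asm) mult_cancel_left) simp
qed

subsection \<open>Binary theta identities\<close>

text \<open>The sign follows the whole exponent k x^2, so \<open>phi (- 1) k\<close> is phi(-q^k)
  for odd k.\<close>

definition phi :: "'a::comm_ring_1 \<Rightarrow> nat \<Rightarrow> 'a fps" where
  "phi e k = gen_fps e UNIV (\<lambda>x::int. k * nat (x\<^sup>2))"

lemma finite_fibres_phi:
  assumes "k > 0"
  shows "finite_fibres S (\<lambda>x::int. k * nat (x\<^sup>2))"
proof (intro finite_fibres_scale finite_fibres_int assms)
  fix x :: int show "\<bar>x\<bar> \<le> int (nat (x\<^sup>2)) + 1" using abs_le_square_int[of x] by simp
qed

lemma phi_phi: "phi e 1 * phi e 3 = gen_fps e UNIV (\<lambda>(x::int, y::int). nat (x\<^sup>2) + 3 * nat (y\<^sup>2))"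
  using gen_fps_times[OF finite_fibres_phi[of 1 UNIV] finite_fibres_phi[of 3 UNIV], of e]
  by (simp add: phi_def)

lemma finite_fibres_theta_theta:
  "j > 0 \<Longrightarrow> k > 0 \<Longrightarrow> finite_fibres S (\<lambda>(x, y). j * tri x + k * tri y)"
  using finite_fibres_times[OF finite_fibres_theta[of j UNIV] finite_fibres_theta[of k UNIV]]
  by (auto intro: finite_fibres_subset)

lemma theta_theta:
  "j > 0 \<Longrightarrow> k > 0 \<Longrightarrow> theta e j * theta e k = gen_fps e UNIV (\<lambda>(x, y). j * tri x + k * tri y)"
  using gen_fps_times[OF finite_fibres_theta[of j UNIV] finite_fibres_theta[of k UNIV], of e]
  by (simp add: theta_def)

lemma X_theta_theta:
  "j > 0 \<Longrightarrow> k > 0 \<Longrightarrow> (fps_X * theta 1 j * theta 1 k :: 'a::comm_ring_1 fps) =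
     gen_fps 1 UNIV (\<lambda>(x, y). Suc (j * tri x + k * tri y))"
  using gen_fps_Suc[of "1::'a" UNIV "\<lambda>(x, y). j * tri x + k * tri y"]
  by (simp add: theta_theta case_prod_unfold mult.assoc)

text \<open>Completing the square gives (x + y/2)^2 + 3 (y/2)^2. Even y yields the integral points
  a^2 + 3 b^2; odd y yields (a - 1/2)^2 + 3 (b - 1/2)^2 = 1 + 2 tri a + 6 tri b.\<close>

lemma hexa_eq_phi_theta:
  "(hexa_fps :: 'a::comm_ring_1 fps) = phi 1 1 * phi 1 3 + fps_X * theta 1 2 * theta 1 6"
proof -
  let ?f = "\<lambda>(a::int, b::int). (a - b, 2 * b)" and ?g = "\<lambda>(a::int, b::int). (a - b, 2 * b - 1)"
  have "UNIV = range ?f \<union> range ?g"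
  proof (intro set_eqI iffI)
    fix v :: "int \<times> int"
    obtain x y where [simp]: "v = (x, y)" by (cases v)
    show "v \<in> range ?f \<union> range ?g"
    proof (cases "even y")
      case True
      then obtain b where "y = 2 * b" by blast
      hence "v = ?f (x + b, b)" by simp
      hence "v \<in> range ?f" by (rule range_eqI)
      thus ?thesis by simp
    next
      case False
      then obtain b where "y = 2 * b + 1" by (rule oddE)
      hence "v = ?g (x + b + 1, b + 1)" by simp
      hence "v \<in> range ?g" by (rule range_eqI)
      thus ?thesis by simp
    qed
  qed auto
  moreover have "even (snd v)" if "v \<in> range ?f" for v using that by auto
  moreover have "odd (snd v)" if "v \<in> range ?g" for v using that by auto
  ultimately have U: "UNIV = range ?f \<union> range ?g" "range ?f \<inter> range ?g = {}" by (simp, meson disjoint_iff)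
  have "(hexa_fps :: 'a fps) = gen_fps 1 (range ?f) hexa + gen_fps 1 (range ?g) hexa"
    using gen_fps_Un[OF finite_fibres_hexa U(2), of "1::'a"] by (simp only: hexa_fps_def U(1)[symmetric])
  moreover have "inj ?f" "inj ?g" by (auto intro!: injI)
  hence "gen_fps 1 (range ?f) hexa = (gen_fps 1 UNIV (\<lambda>v. hexa (?f v)) :: 'a fps)"
        "gen_fps 1 (range ?g) hexa = (gen_fps 1 UNIV (\<lambda>v. hexa (?g v)) :: 'a fps)"
    by (simp_all only: gen_fps_range)
  moreover have "(\<lambda>v. hexa (?f v)) = (\<lambda>(a, b). nat (a\<^sup>2) + 3 * nat (b\<^sup>2))"
  proof -
    have "int (hexa (a - b, 2 * b)) = int (nat (a\<^sup>2) + 3 * nat (b\<^sup>2))" for a b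
      unfolding int_hexa by (simp add: power2_eq_square algebra_simps)
    thus ?thesis by (simp only: of_nat_eq_iff) (simp add: fun_eq_iff)
  qed
  moreover have "(\<lambda>v. hexa (?g v)) = (\<lambda>(a, b). Suc (2 * tri a + 6 * tri b))"
  proof -
    have "int (hexa (a - b, 2 * b - 1)) = int (Suc (2 * tri a + 6 * tri b))" for a b
      unfolding int_hexa using two_tri[of a] two_tri[of b] by (simp add: power2_eq_square algebra_simps)
    thus ?thesis by (simp only: of_nat_eq_iff) (simp add: fun_eq_iff)
  qed
  ultimately show ?thesis by (simp only: phi_phi X_theta_theta zero_less_numeral)
qed

text \<open>Passing from q to -q changes the series by twice its odd part, the sum over x + y odd. A
  symmetry of the hexagonal lattice carries these points to half of the half-integral ones.\<close>

lemma phi_1_eq_phi_minus_1: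
  "(phi 1 1 * phi 1 3 :: 'a::comm_ring_1 fps) = phi (- 1) 1 * phi (- 1) 3 + fps_X * theta 1 2 * theta 1 6"
proof -
  define f where "f = (\<lambda>(x::int, y::int). nat (x\<^sup>2) + 3 * nat (y\<^sup>2))"
  define g where "g = (\<lambda>(a, b). Suc (2 * tri a + 6 * tri b))"
  define Od where "Od = {(x::int, y::int). odd (x + y)}"
  define E where "E = {(a::int, b::int). even (a - b)}"
  have odd_f: "odd (f v) \<longleftrightarrow> v \<in> Od" for v
  proof -
    obtain x y where v: "v = (x, y)" by (cases v)
    have "odd (int (f v)) \<longleftrightarrow> v \<in> Od" by (simp add: v f_def Od_def)
    thus ?thesis by simp
  qed
  have "gen_fps 1 UNIV f = gen_fps (- 1) UNIV f + (2 * gen_fps 1 Od f :: 'a fps)"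
  proof (rule fps_ext)
    fix n
    have "{v \<in> Od. f v = n} = (if odd n then {v. f v = n} else {})" using odd_f by auto
    thus "gen_fps 1 UNIV f $ n = (gen_fps (- 1) UNIV f + (2 * gen_fps 1 Od f :: 'a fps)) $ n"
      by (simp only: mult_2 fps_add_nth gen_fps_nth) auto
  qed
  also have "gen_fps 1 Od f = (gen_fps 1 E g :: 'a fps)"
  proof (rule gen_fps_bij[symmetric])
    \<comment> \<open>With A = a - 1/2 and B = b - 1/2 this is (A, B) -> ((A + 3B)/2, (A - B)/2): up
      to conjugation, A + B sqrt(-3) times a sixth root of unity. It preserves A^2 + 3 B^2 = 1 + 2
      tri a + 6 tri b.\<close>
    show "bij_betw (\<lambda>(a, b). ((a + 3 * b - 2) div 2, (a - b) div 2)) E Od"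
    proof (rule bij_betw_byWitness[of _ "\<lambda>(x, y). ((x + 3 * y + 1) div 2, (x - y + 1) div 2)"])
      let ?h = "\<lambda>(a, b). ((a + 3 * b - 2) div 2, (a - b) div (2::int))"
      let ?k = "\<lambda>(x, y). ((x + 3 * y + 1) div 2, (x - y + 1) div (2::int))"
      have h: "?h v \<in> Od \<and> ?k (?h v) = v" if "v \<in> E" for v
      proof -
        obtain a b where v: "v = (a, b)" by (cases v)
        with that have "even (a - b)" by (simp only: E_def mem_Collect_eq case_prod_conv)
        then obtain c where "a - b = 2 * c" by (rule evenE)
        hence a: "a = b + 2 * c" by simp
        have "(a + 3 * b - 2) div 2 = 2 * b + c - 1" "(a - b) div 2 = c" unfolding a by presburger+
        hence "?h v = (2 * b + c - 1, c)" by (simp add: v)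
        thus ?thesis by (simp add: Od_def v a)
      qed
      have k: "?k v \<in> E \<and> ?h (?k v) = v" if "v \<in> Od" for v
      proof -
        obtain x y where v: "v = (x, y)" by (cases v)
        with that have "odd (x + y)" by (simp only: Od_def mem_Collect_eq case_prod_conv not_False_eq_True)
        then obtain c where "x + y = 2 * c + 1" by (rule oddE)
        hence x: "x = 2 * c + 1 - y" by simp
        have "(x + 3 * y + 1) div 2 = c + y + 1" "(x - y + 1) div 2 = c - y + 1" unfolding x by presburger+
        hence "?k v = (c + y + 1, c - y + 1)" by (simp add: v)
        thus ?thesis by (simp add: E_def v x)
      qed
      show "\<forall>v\<in>E. ?k (?h v) = v" "\<forall>v\<in>Od. ?h (?k v) = v" using h k by blast+
      show "?h ` E \<subseteq> Od" "?k ` Od \<subseteq> E" using h k by blast+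
    qed
    fix v assume v: "v \<in> E"
    obtain a b where ab: "v = (a, b)" by (cases v)
    with v have "even (a - b)" by (simp only: E_def mem_Collect_eq case_prod_conv)
    then obtain c where "a - b = 2 * c" by (rule evenE)
    hence a: "a = b + 2 * c" by simp
    have "(a + 3 * b - 2) div 2 = 2 * b + c - 1" "(a - b) div 2 = c" unfolding a by presburger+
    moreover have "int (f (2 * b + c - 1, c)) = int (g (a, b))"
      using two_tri[of a] two_tri[of b] unfolding a
      by (simp add: f_def g_def) (simp add: power2_eq_square algebra_simps)
    ultimately show "f (case v of (a, b) \<Rightarrow> ((a + 3 * b - 2) div 2, (a - b) div 2)) = g v"
      by (simp add: ab)
  qed
  also have "2 * gen_fps 1 E g = (gen_fps 1 UNIV g :: 'a fps)"
  proof -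
    \<comment> \<open>The reflection b -> 1 - b preserves \<open>g\<close> and flips the parity of a
      - b, so \<open>E\<close> carries exactly half of the full sum.\<close>
    have eq: "gen_fps 1 E g = (gen_fps 1 (- E) g :: 'a fps)"
    proof (rule gen_fps_bij)
      show "bij_betw (\<lambda>(a, b). (a, 1 - b)) E (- E)"
        by (rule bij_betw_byWitness[of _ "\<lambda>(a, b). (a, 1 - b)"]) (auto simp: E_def)
    qed (auto simp: g_def tri_minus)
    have "finite_fibres (E \<union> - E) g"
    proof -
      have "finite_fibres UNIV (\<lambda>v. Suc ((\<lambda>(a, b). 2 * tri a + 6 * tri b) v))"
        unfolding finite_fibres_def
      proof
        fix n show "finite {v \<in> UNIV. Suc ((\<lambda>(a, b). 2 * tri a + 6 * tri b) v) = n}"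
          using finite_fibres_theta_theta[of 2 6 UNIV] by (cases n) (auto simp: finite_fibres_def)
      qed
      thus ?thesis by (simp add: g_def case_prod_unfold)
    qed
    from gen_fps_Un[OF this, of "1::'a"] show ?thesis
      unfolding eq[symmetric] by (simp only: mult_2 Compl_partition Compl_disjoint simp_thms)
  qed
  finally show ?thesis by (simp only: phi_phi X_theta_theta f_def g_def zero_less_numeral)
qed

lemma hexa_eq_phi_minus_theta:
  "(hexa_fps :: 'a::comm_ring_1 fps) = phi (- 1) 1 * phi (- 1) 3 + 2 * (fps_X * theta 1 2 * theta 1 6)"
  unfolding hexa_eq_phi_theta phi_1_eq_phi_minus_1 by simp

text \<open>Pairs of equal parity are (s + m, s - m), whose triangular numbers add up to m^2 + 2 tri
  s. Reflecting one coordinate shows that pairs of opposite parity contribute the same, hence the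
  factor 2.\<close>

lemma theta_square: "(theta e 1 :: 'a::comm_ring_1 fps)\<^sup>2 = 2 * phi e 1 * theta e 2"
proof -
  define f where "f = (\<lambda>(x, y). tri x + tri y)"
  define E where "E = {(a::int, b::int). even (a - b)}"
  have fin: "finite_fibres S f" for S
    using finite_fibres_theta_theta[of 1 1] by (simp add: f_def)
  have "(theta e 1)\<^sup>2 = gen_fps e UNIV f"
    by (simp add: power2_eq_square theta_theta f_def)
  also have "\<dots> = gen_fps e E f + gen_fps e (- E) f"
    using gen_fps_Un[of E "- E" f e] fin by simp
  also have "gen_fps e (- E) f = gen_fps e E f"
  proof (rule gen_fps_bij)
    show "bij_betw (\<lambda>(a, b). (a, 1 - b)) (- E) E"
      by (rule bij_betw_byWitness[of _ "\<lambda>(a, b). (a, 1 - b)"]) (auto simp: E_def)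
  qed (auto simp: f_def tri_minus)
  also have "gen_fps e E f = gen_fps e (UNIV \<times> UNIV) (\<lambda>(m, s). 1 * nat (m\<^sup>2) + 2 * tri s)"
  proof (rule gen_fps_bij[symmetric])
    show "bij_betw (\<lambda>(m, s). (s + m, s - m)) (UNIV \<times> UNIV) E"
    proof (rule bij_betw_byWitness[of _ "\<lambda>(x, y). ((x - y) div 2, (x + y) div 2)"])
      show "\<forall>v\<in>E. (\<lambda>(m, s). (s + m, s - m)) (case v of (x, y) \<Rightarrow> ((x - y) div 2, (x + y) div 2)) = v"
      proof
        fix v assume v: "v \<in> E"
        obtain x y where xy: "v = (x, y)" by (cases v)
        with v have "even (x - y)" by (simp only: E_def mem_Collect_eq case_prod_conv)
        then obtain c where "x - y = 2 * c" by (rule evenE)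
        hence x: "x = y + 2 * c" by simp
        have "(x + y) div 2 = y + c" unfolding x by presburger
        thus "(\<lambda>(m, s). (s + m, s - m)) (case v of (x, y) \<Rightarrow> ((x - y) div 2, (x + y) div 2)) = v"
          by (simp add: xy x)
      qed
    qed (auto simp: E_def)
    fix v :: "int \<times> int"
    obtain m s where v: "v = (m, s)" by (cases v)
    have "2 * int (tri (s + m) + tri (s - m)) = 2 * int (1 * nat (m\<^sup>2) + 2 * tri s)"
      unfolding of_nat_add distrib_left two_tri using two_tri[of s]
      by (simp add: power2_eq_square algebra_simps)
    thus "f (case v of (m, s) \<Rightarrow> (s + m, s - m)) = (case v of (m, s) \<Rightarrow> 1 * nat (m\<^sup>2) + 2 * tri s)"
      unfolding mult_cancel_left of_nat_eq_iff by (simp add: v f_def)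
  qed
  also have "\<dots> = phi e 1 * theta e 2"
    unfolding phi_def theta_def by (intro gen_fps_times finite_fibres_phi finite_fibres_theta) auto
  finally show ?thesis by (simp only: mult_2 distrib_right)
qed

lemma theta_minus_1_even: "even k \<Longrightarrow> theta (- 1) k = theta 1 k"
proof (rule fps_ext)
  fix n assume "even k"
  hence "odd n \<Longrightarrow> {x. k * tri x = n} = {}" by auto
  thus "theta (- 1) k $ n = theta 1 k $ n" by (cases "even n") (simp_all add: theta_def)
qed

subsection \<open>Product expansions\<close>

text \<open>
  Shanks' finite form of Gauss's product for \<open>\<psi>\<close>, cleared of denominators; the inductive step
  telescopes along \<open>h\<close>.
\<close>

lemma gauss_finite_identity:
  fixes x :: "'a::comm_ring_1"
  shows "(\<Prod>t<n. 1 - x ^ (2 * t + 1)) * (\<Sum>s<2 * n. x ^ (s * (s + 1) div 2)) =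
     (\<Sum>s<n. (\<Prod>t\<in>{s..<n}. 1 - x ^ (2 * t + 2)) * (\<Prod>t<s. 1 - x ^ (2 * t + 1)) * x ^ (s * (2 * n + 1)))"
proof (induction n)
  case (Suc n)
  define D where "D = (\<lambda>n. \<Prod>t<n. 1 - x ^ (2 * t + 1))"
  define B where "B = (\<lambda>n s. (\<Prod>t\<in>{s..<n}. 1 - x ^ (2 * t + 2)) * D s)"
  define S where "S = (\<lambda>n. \<Sum>s<2 * n. x ^ (s * (s + 1) div 2))"
  define h where "h = (\<lambda>s. B n s * x ^ (s * (2 * n + 1)) * (1 - x ^ (2 * s)))"
  \<comment> \<open>Since B (Suc n) s = (1 - x^(2n+2)) B n s, the difference consists of the s-th
    summand for n + 1 minus the s-th summand for n times the new factor of D.\<close>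
  have step: "h (Suc s) - h s =
      (1 - x ^ (2 * n + 2)) * B n s * x ^ (s * (2 * n + 3)) - (1 - x ^ (2 * n + 1)) * (B n s * x ^ (s * (2 * n + 1)))"
    if "s < n" for s
  proof -
    define P where "P = (\<Prod>t\<in>{Suc s..<n}. 1 - x ^ (2 * t + 2))"
    define y where "y = x ^ (s * (2 * n + 1))"
    define u where "u = x ^ (2 * s)"
    define w where "w = x ^ (2 * n + 1)"
    have "B n s = (1 - x ^ (2 * s + 2)) * P * D s"
      using that by (simp add: B_def P_def prod.atLeast_Suc_lessThan)
    hence B: "B n s = (1 - u * x * x) * P * D s" by (simp add: u_def power_add mult_ac)
    have "B n (Suc s) = P * ((1 - x ^ (2 * s + 1)) * D s)"
      by (simp add: B_def P_def D_def)
    hence B': "B n (Suc s) = P * ((1 - u * x) * D s)" by (simp add: u_def mult_ac)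
    have e: "x ^ (Suc s * (2 * n + 1)) = y * w" "x ^ (s * (2 * n + 3)) = y * u" "x ^ (2 * n + 2) = w * x"
      "x ^ (2 * Suc s) = u * x * x"
      unfolding y_def w_def u_def power_add[symmetric] power_Suc[symmetric] power_Suc2[symmetric]
      by (simp_all add: algebra_simps)
    show ?thesis
      unfolding h_def e B B' y_def[symmetric] u_def[symmetric] w_def[symmetric]
      by (simp add: algebra_simps)
  qed
  have IH: "D n * S n = (\<Sum>s<n. B n s * x ^ (s * (2 * n + 1)))"
    using Suc by (simp add: D_def S_def B_def)
  define z where "z = x ^ (n * (2 * n + 1))"
  define v where "v = x ^ (2 * n)"
  have p: "x ^ ((n + 1) * (2 * n + 1)) = z * v * x" "x ^ (n * (2 * n + 3)) = z * v" "x ^ (2 * n + 1) = v * x"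
      "x ^ (2 * n + 2) = v * x * x"
    unfolding z_def v_def power_add[symmetric] power_Suc[symmetric] power_Suc2[symmetric]
    by (simp_all add: algebra_simps)
  have S: "S (Suc n) = S n + z + z * v * x"
  proof -
    have "2 * n * (2 * n + 1) div 2 = n * (2 * n + 1)" by simp
    moreover have "(2 * n + 1) * (2 * n + 1 + 1) div 2 = (n + 1) * (2 * n + 1)"
    proof -
      have "(2 * n + 1) * (2 * n + 1 + 1) = 2 * ((n + 1) * (2 * n + 1))" by (simp add: algebra_simps)
      thus ?thesis by simp
    qed
    moreover have "S (Suc n) = S n + x ^ (2 * n * (2 * n + 1) div 2) + x ^ ((2 * n + 1) * (2 * n + 1 + 1) div 2)"
      by (simp add: S_def)
    ultimately show ?thesis by (simp only: p z_def)
  qed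
  have D: "D (Suc n) = (1 - v * x) * D n" unfolding D_def prod.lessThan_Suc p by (rule mult.commute)
  have BS: "B (Suc n) s = (1 - v * x * x) * B n s" if "s \<le> n" for s
    unfolding B_def prod.atLeastLessThan_Suc[OF that] p by (simp only: mult_ac)
  have Bn: "B n n = D n" by (simp add: B_def)
  have "(\<Sum>s<n. h (Suc s) - h s) = h n - h 0" by (rule sum_lessThan_telescope)
  also have "\<dots> = D n * z * (1 - v)" by (simp add: h_def Bn z_def v_def)
  finally have "(\<Sum>s<n. (1 - v * x * x) * B n s * x ^ (s * (2 * n + 3)) - (1 - v * x) * (B n s * x ^ (s * (2 * n + 1)))) = D n * z * (1 - v)"
    using step unfolding p by simp
  hence key: "(\<Sum>s<n. (1 - v * x * x) * B n s * x ^ (s * (2 * n + 3))) = (1 - v * x) * (D n * S n) + D n * z * (1 - v)"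
    unfolding IH sum_subtractf sum_distrib_left by (simp only: diff_eq_eq add.commute)
  \<comment> \<open>The new powers z and z v x contribute D n z (1 - v^2 x^2), which splits into the
    boundary term of the telescoping sum and the summand s = n.\<close>
  have "D (Suc n) * S (Suc n) = (1 - v * x) * (D n * S n) + D n * z * (1 - v) + (1 - v * x * x) * D n * (z * v)"
    unfolding D S by (simp add: algebra_simps)
  also have "\<dots> = (\<Sum>s<n. B (Suc n) s * x ^ (s * (2 * n + 3))) + B (Suc n) n * x ^ (n * (2 * n + 3))"
    unfolding key[symmetric] p BS[OF order_refl] Bn by (intro arg_cong2[of _ _ _ _ "(+)"] sum.cong) (auto simp: BS)
  also have "\<dots> = (\<Sum>s<Suc n. B (Suc n) s * x ^ (s * (2 * Suc n + 1)))"
    by (simp add: eval_nat_numeral)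
  finally show ?case by (simp add: D_def S_def B_def)
qed simp

section \<open>Congruence modulo X^k, where finite products replace infinite ones\<close>

definition fps_cong :: "nat \<Rightarrow> 'a::comm_ring_1 fps \<Rightarrow> 'a fps \<Rightarrow> bool" where
  "fps_cong k F G \<longleftrightarrow> (\<forall>i<k. F $ i = G $ i)"

lemma fps_cong_refl [simp]: "fps_cong k F F"
  and fps_cong_sym: "fps_cong k F G \<Longrightarrow> fps_cong k G F"
  and fps_cong_trans [trans]: "fps_cong k F G \<Longrightarrow> fps_cong k G H \<Longrightarrow> fps_cong k F H"
  by (auto simp: fps_cong_def)

lemma fps_cong_mult: "fps_cong k F F' \<Longrightarrow> fps_cong k G G' \<Longrightarrow> fps_cong k (F * G) (F' * G')"
  by (auto simp: fps_cong_def fps_mult_nth intro!: sum.cong)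

text \<open>In an integral domain the lowest coefficient in which F and G differ survives
  multiplication by a series with nonzero constant term.\<close>

lemma fps_cong_mult_cancel:
  fixes F G H :: "'a::idom fps"
  assumes "fps_cong k (H * F) (H * G)" "H $ 0 \<noteq> 0"
  shows "fps_cong k F G"
proof -
  have "F $ i = G $ i" if "i < k" for i
    using that
  proof (induction i rule: less_induct)
    case (less i)
    have "0 = (H * F) $ i - (H * G) $ i" using assms(1) less.prems by (simp add: fps_cong_def)
    also have "\<dots> = (\<Sum>j=0..i. H $ j * (F $ (i - j) - G $ (i - j)))"
      by (simp add: fps_mult_nth sum_subtractf right_diff_distrib)
    also have "\<dots> = (\<Sum>j\<in>{0}. H $ j * (F $ (i - j) - G $ (i - j)))"
      by (rule sum.mono_neutral_right) (use less in auto)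
    finally show ?case using assms(2) by simp
  qed
  thus ?thesis by (simp add: fps_cong_def)
qed

lemma fps_cong_compose_X_power:
  "fps_cong k F G \<Longrightarrow> fps_cong k (F oo fps_X ^ d) (G oo fps_X ^ d)"
  by (auto simp: fps_cong_def fps_nth_compose_X_power) (meson div_le_dividend le_less_trans)

lemma fps_cong_prod_one_minus:
  assumes "\<And>t. t \<in> T \<Longrightarrow> k \<le> f t"
  shows "fps_cong k (\<Prod>t\<in>T. 1 - fps_X ^ f t) (1 :: 'a::comm_ring_1 fps)"
  using assms
proof (induction T rule: infinite_finite_induct)
  case (insert t T)
  have "fps_cong k ((1 - fps_X ^ f t) * (\<Prod>t\<in>T. 1 - fps_X ^ f t)) (1 * 1 :: 'a fps)"
  proof (rule fps_cong_mult)
    show "fps_cong k (1 - fps_X ^ f t) (1 :: 'a fps)" using insert.prems[of t] by (auto simp: fps_cong_def)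
    show "fps_cong k (\<Prod>t\<in>T. 1 - fps_X ^ f t) (1 :: 'a fps)" by (rule insert.IH) (use insert.prems in auto)
  qed
  thus ?case using insert.hyps by simp
qed auto

lemma tri_nat: "tri (int s + 1) = s * (s + 1) div 2" "tri (- int s) = s * (s + 1) div 2"
proof -
  have "2 * (s * (s + 1) div 2) = s * (s + 1)" by simp
  hence "2 * int (s * (s + 1) div 2) = int s * (int s + 1)" by (metis of_nat_mult of_nat_numeral of_nat_add of_nat_1)
  thus "tri (int s + 1) = s * (s + 1) div 2" "tri (- int s) = s * (s + 1) div 2"
    by (auto intro!: tri_eqI simp: algebra_simps)
qed

lemma theta_nat: "theta e 1 = 2 * gen_fps e UNIV (\<lambda>s::nat. s * (s + 1) div 2)"
proof -
  let ?f = "\<lambda>s. int s + 1" and ?g = "\<lambda>s. - int s"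
  have U: "range ?f \<union> range ?g = UNIV"
  proof (intro set_eqI iffI)
    fix x :: int
    have "x = ?f (nat (x - 1)) \<or> x = ?g (nat (- x))" by auto
    thus "x \<in> range ?f \<union> range ?g" by blast
  qed auto
  have "range ?f \<inter> range ?g = {}" by auto
  from gen_fps_Un[OF finite_fibres_tri this, of e]
  have "theta e 1 = gen_fps e (range ?f) tri + gen_fps e (range ?g) tri"
    by (simp only: U theta_def mult_1_left)
  moreover have "inj ?f" "inj ?g" by (auto intro!: injI)
  ultimately show ?thesis by (simp only: gen_fps_range tri_nat mult_2)
qed

lemma gen_fps_cong_sum:
  fixes g :: "nat \<Rightarrow> nat"
  assumes "\<And>s. s \<ge> m \<Longrightarrow> k \<le> g s"
  shows "fps_cong k (gen_fps e UNIV g) (\<Sum>s<m. (fps_const e * fps_X) ^ g s)"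
  unfolding fps_cong_def
proof (intro allI impI)
  fix i assume i: "i < k"
  have "s < m" if "g s = i" for s using assms[of s] i that by (cases "s < m") auto
  hence eq: "{s. g s = i} = {s \<in> {..<m}. g s = i}" by auto
  have "(\<Sum>s<m. (fps_const e * fps_X) ^ g s) $ i = (\<Sum>s<m. if g s = i then e ^ i else 0)"
    unfolding fps_sum_nth by (intro sum.cong) (auto simp: power_mult_distrib fps_const_power)
  also have "\<dots> = e ^ i * of_nat (card {s. g s = i})"
    by (subst eq) (simp add: sum.If_cases Int_def mult.commute)
  finally show "gen_fps e UNIV g $ i = (\<Sum>s<m. (fps_const e * fps_X) ^ g s) $ i" by simp
qed

text \<open>Gauss's product, truncated. In \<open>gauss_finite_identity\<close> with x = e X the
  right-hand terms with s > 0 are divisible by x^(2n+1), so only s = 0 remains; the triangular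
  numbers missing on the left are at least n(2n + 1). As e^2 = 1, even powers of x are powers of
  X.\<close>

lemma theta_product_cong:
  fixes e :: "'a::comm_ring_1"
  assumes "e\<^sup>2 = 1" "n > 0"
  shows "fps_cong (2 * n + 1) ((\<Prod>t<n. 1 - (fps_const e * fps_X) ^ (2 * t + 1)) * theta e 1)
           (2 * (\<Prod>t<n. 1 - fps_X ^ (2 * t + 2)))"
proof -
  define x where "x = fps_const e * fps_X"
  define B where "B = (\<lambda>s. (\<Prod>t\<in>{s..<n}. 1 - x ^ (2 * t + 2)) * (\<Prod>t<s. 1 - x ^ (2 * t + 1)))"
  have "2 * n + 1 \<le> s * (s + 1) div 2" if "s \<ge> 2 * n" for s
  proof -
    have "n * (2 * n + 1) = 2 * n * (2 * n + 1) div 2" by simp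
    also have "\<dots> \<le> s * (s + 1) div 2" using that by (intro div_le_mono mult_le_mono) auto
    finally show ?thesis using assms(2) by (metis le_trans mult_le_mono1 mult_1 Suc_leI One_nat_def)
  qed
  hence "fps_cong (2 * n + 1) (2 * gen_fps e UNIV (\<lambda>s. s * (s + 1) div 2)) (2 * (\<Sum>s<2 * n. x ^ (s * (s + 1) div 2)))"
    unfolding x_def by (intro fps_cong_mult gen_fps_cong_sum fps_cong_refl)
  hence "fps_cong (2 * n + 1) ((\<Prod>t<n. 1 - x ^ (2 * t + 1)) * theta e 1)
          ((\<Prod>t<n. 1 - x ^ (2 * t + 1)) * (2 * (\<Sum>s<2 * n. x ^ (s * (s + 1) div 2))))"
    unfolding theta_nat by (rule fps_cong_mult[OF fps_cong_refl])
  also have "(\<Prod>t<n. 1 - x ^ (2 * t + 1)) * (2 * (\<Sum>s<2 * n. x ^ (s * (s + 1) div 2))) =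
      2 * (\<Sum>s<n. B s * x ^ (s * (2 * n + 1)))"
    using gauss_finite_identity[of x n] unfolding B_def by (simp only: mult.left_commute)
  also have "fps_cong (2 * n + 1) \<dots> (2 * B 0)"
  proof (rule fps_cong_mult[OF fps_cong_refl])
    have "fps_cong (2 * n + 1) (\<Sum>s<n. B s * x ^ (s * (2 * n + 1))) (\<Sum>s<n. if s = 0 then B 0 else 0)"
      unfolding fps_cong_def
    proof (intro allI impI)
      fix i assume i: "i < 2 * n + 1"
      have "(B s * x ^ (s * (2 * n + 1))) $ i = (if s = 0 then B 0 else 0) $ i" for s
      proof (cases "s = 0")
        case False
        hence "i < s * (2 * n + 1)" using i by (metis less_le_trans mult_le_mono1 mult_1 Suc_leI One_nat_def neq0_conv)
        moreover have "B s * x ^ (s * (2 * n + 1)) = fps_X ^ (s * (2 * n + 1)) * (B s * fps_const e ^ (s * (2 * n + 1)))"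
          by (simp add: x_def power_mult_distrib mult_ac)
        ultimately show ?thesis using False by (simp only: fps_X_power_mult_nth) simp
      qed simp
      thus "(\<Sum>s<n. B s * x ^ (s * (2 * n + 1))) $ i = (\<Sum>s<n. if s = 0 then B 0 else 0) $ i"
        by (simp only: fps_sum_nth)
    qed
    thus "fps_cong (2 * n + 1) (\<Sum>s<n. B s * x ^ (s * (2 * n + 1))) (B 0)"
      using assms(2) by (simp add: sum.delta)
  qed
  also have "B 0 = (\<Prod>t<n. 1 - fps_X ^ (2 * t + 2))"
  proof -
    have "x\<^sup>2 = fps_X\<^sup>2" using assms(1) by (simp add: x_def power_mult_distrib fps_const_power)
    hence "x ^ (2 * t + 2) = fps_X ^ (2 * t + 2)" for t
      by (metis power_mult add_mult_distrib2 mult.right_neutral add.commute distrib_left)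
    thus ?thesis by (simp only: B_def atLeast0LessThan) simp
  qed
  finally show ?thesis by (simp only: x_def)
qed

lemma prod_one_minus_compose_X_power:
  fixes f :: "'b \<Rightarrow> nat"
  assumes "d > 0"
  shows "(\<Prod>t\<in>T. 1 - fps_X ^ f t) oo fps_X ^ d = (\<Prod>t\<in>T. 1 - fps_X ^ (d * f t) :: 'a::idom fps)"
  using assms
  by (simp add: fps_compose_prod_distrib fps_compose_sub_distrib flip: fps_compose_power)
     (simp add: power_mult)

lemma fps_prod_nth_0: "(\<Prod>t\<in>T. f t :: 'a::comm_ring_1 fps) $ 0 = (\<Prod>t\<in>T. f t $ 0)"
  by (induction T rule: infinite_finite_induct) simp_all

lemma prod_lessThan_double:
  fixes f :: "nat \<Rightarrow> 'a::comm_monoid_mult"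
  shows "(\<Prod>t<2 * n. f t) = (\<Prod>t<n. f (2 * t)) * (\<Prod>t<n. f (2 * t + 1))"
  by (induction n) (simp_all add: mult_ac)

text \<open>For \<open>e = - 1\<close>, \<open>theta_square\<close> reads psi(-q)^2 = phi(-q)
  psi(q^2). The products for psi(q), psi(-q) and psi(q^2) turn phi(-q) psi(q) into N^2 / (b M), and
  b M = R / Q by differences of squares. Divisions appear as cancellations in congruences.\<close>

lemma phi_theta_product_cong:
  assumes "n > 0"
  shows "fps_cong (2 * n + 1) (phi (- 1) 1 * theta 1 1 :: 'a::{idom,ring_char_0} fps)
     (2 * ((\<Prod>t<2 * n. 1 - fps_X ^ (t + 1)) * (\<Prod>t<2 * n. 1 - fps_X ^ (2 * t + 2))))"
proof -
  define K where "K = 2 * n + 1"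
  define a where "a = (\<Prod>t<n. 1 - fps_X ^ (2 * t + 1) :: 'a fps)"
  define b where "b = (\<Prod>t<n. 1 + fps_X ^ (2 * t + 1) :: 'a fps)"
  define N where "N = (\<Prod>t<n. 1 - fps_X ^ (2 * t + 2) :: 'a fps)"
  define M where "M = (\<Prod>t<n. 1 + fps_X ^ (2 * t + 2) :: 'a fps)"
  define Q where "Q = (\<Prod>t<2 * n. 1 - fps_X ^ (t + 1) :: 'a fps)"
  define R where "R = (\<Prod>t<2 * n. 1 - fps_X ^ (2 * t + 2) :: 'a fps)"
  let ?p = "phi (- 1) 1 :: 'a fps" and ?t = "theta 1 1 :: 'a fps" and ?u = "theta (- 1) 1 :: 'a fps"
    and ?t2 = "theta 1 2 :: 'a fps"
  have diff_squares: "(1 - fps_X ^ m) * (1 + fps_X ^ m) = (1 - fps_X ^ (2 * m) :: 'a fps)" for m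
  proof -
    have "(1 - y) * (1 + y) = 1 - y * y" for y :: "'a fps" by (simp add: algebra_simps)
    thus ?thesis by (simp only: mult_2 power_add)
  qed
  have t: "fps_cong K (a * ?t) (2 * N)"
    using theta_product_cong[of "1::'a" n] assms by (simp add: K_def a_def N_def)
  have u: "fps_cong K (b * ?u) (2 * N)"
  proof -
    have "(fps_const (- 1) * fps_X :: 'a fps) = - fps_X" by (simp flip: fps_const_neg)
    hence "1 - (fps_const (- 1) * fps_X :: 'a fps) ^ (2 * t + 1) = 1 + fps_X ^ (2 * t + 1)" for t
      by (simp only: power_minus_odd odd_two_times_div_two_succ) simp
    moreover have "(- 1 :: 'a)\<^sup>2 = 1" by simp
    ultimately show ?thesis using theta_product_cong[of "- 1::'a" n] assms
      by (simp only: K_def b_def N_def simp_thms)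
  qed
  \<comment> \<open>Substituting q^2 in \<open>t\<close> keeps the precision; a(q^2) = a b and
    N(q^2) = N M.\<close>
  have t2: "fps_cong K (a * b * ?t2) (2 * (N * M))"
  proof -
    have "fps_cong K ((a * ?t) oo fps_X ^ 2) ((2 * N) oo fps_X ^ 2)"
      by (rule fps_cong_compose_X_power[OF t])
    moreover have "(a * ?t) oo fps_X ^ 2 = (a oo fps_X ^ 2) * ?t2"
      by (simp add: fps_compose_mult_distrib theta_scale[of 2])
    moreover have "a oo fps_X ^ 2 = a * b"
      by (simp only: a_def b_def prod_one_minus_compose_X_power zero_less_numeral diff_squares prod.distrib[symmetric])
    moreover have "(2 * N) oo fps_X ^ 2 = 2 * (N oo fps_X ^ 2)"
      by (simp add: fps_compose_mult_distrib numeral_fps_const)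
    moreover have "N oo fps_X ^ 2 = N * M"
      by (simp only: N_def M_def prod_one_minus_compose_X_power zero_less_numeral diff_squares prod.distrib[symmetric])
    ultimately show ?thesis by simp
  qed
  have sq: "?u * ?u = 2 * ?p * ?t2"
    using theta_square[of "- 1::'a"] theta_minus_1_even[of 2, where 'a='a] by (simp add: power2_eq_square)
  have N0: "N $ 0 = 1" and a0: "a $ 0 = 1" by (simp_all add: N_def a_def fps_prod_nth_0)
  have "fps_cong K ((4 * (N * a)) * (?p * ?t * (b * M))) (2 * ?p * (2 * (N * M)) * b * (a * ?t))"
    by (simp add: mult_ac)
  also have "fps_cong K \<dots> (2 * ?p * (a * b * ?t2) * b * (a * ?t))"
    by (intro fps_cong_mult fps_cong_refl fps_cong_sym[OF t2])
  also have "\<dots> = (2 * ?p * ?t2) * (b * b * a * (a * ?t))" by (simp only: mult_ac)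
  also have "\<dots> = (b * ?u) * (b * ?u) * a * (a * ?t)" unfolding sq[symmetric] by (simp only: mult_ac)
  also have "fps_cong K \<dots> ((2 * N) * (2 * N) * a * (2 * N))"
    by (intro fps_cong_mult fps_cong_refl t u)
  also have "\<dots> = (4 * (N * a)) * (2 * (N * N))" by simp
  finally have "fps_cong K (?p * ?t * (b * M)) (2 * (N * N))"
  proof (rule fps_cong_mult_cancel)
    show "(4 * (N * a)) $ 0 \<noteq> 0"
      by (simp add: N0 a0)
  qed
  hence "fps_cong K (?p * ?t * (b * M) * Q) (2 * (N * N) * Q)"
    by (rule fps_cong_mult[OF _ fps_cong_refl])
  moreover have bMQ: "b * M * Q = R"
  proof -
    have "b * M = (\<Prod>t<2 * n. 1 + fps_X ^ (t + 1))"
      unfolding prod_lessThan_double b_def M_def by simp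
    hence "b * M * Q = (\<Prod>t<2 * n. 1 + fps_X ^ (t + 1)) * Q" by (simp only:)
    also have "\<dots> = (\<Prod>t<2 * n. (1 - fps_X ^ (t + 1)) * (1 + fps_X ^ (t + 1)))"
      unfolding Q_def prod.distrib by (rule mult.commute)
    also have "\<dots> = R" unfolding diff_squares R_def by simp
    finally show ?thesis .
  qed
  ultimately have pR: "fps_cong K (?p * ?t * R) (2 * (N * N) * Q)"
    by (simp only: mult.assoc)
  \<comment> \<open>\<open>R\<close> has n more factors than \<open>N\<close>, all congruent to 1
    since their exponents start at 2n + 2.\<close>
  have RN: "fps_cong K R N"
  proof -
    have "R = N * (\<Prod>t\<in>{n..<2 * n}. 1 - fps_X ^ (2 * t + 2))"
    proof -
      have "R = (\<Prod>t\<in>{..<n} \<union> {n..<2 * n}. 1 - fps_X ^ (2 * t + 2))"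
        unfolding R_def by (rule prod.cong) auto
      also have "\<dots> = N * (\<Prod>t\<in>{n..<2 * n}. 1 - fps_X ^ (2 * t + 2))"
        unfolding N_def by (rule prod.union_disjoint) auto
      finally show ?thesis .
    qed
    also have "fps_cong K \<dots> (N * 1)"
      by (intro fps_cong_mult fps_cong_refl fps_cong_prod_one_minus) (auto simp: K_def)
    finally show ?thesis by simp
  qed
  have "fps_cong K (N * (?p * ?t)) (?p * ?t * R)"
    by (subst mult.commute) (intro fps_cong_mult fps_cong_refl fps_cong_sym[OF RN])
  also note pR
  also have "2 * (N * N) * Q = N * (2 * (Q * N))" by (simp only: mult_ac)
  finally have "fps_cong K (?p * ?t) (2 * (Q * N))"
    by (rule fps_cong_mult_cancel) (simp add: N0)
  also have "fps_cong K \<dots> (2 * (Q * R))"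
    by (intro fps_cong_mult fps_cong_refl fps_cong_sym[OF RN])
  finally show ?thesis by (simp only: K_def Q_def R_def)
qed

section \<open>The eta product as a product of theta series\<close>

lemma coeff_eta_poly: "of_int (eta_coeff n) = coeff (eta_poly (- 1 :: complex) n) n"
proof -
  have "\<forall>n. \<exists>z::int. coeff (eta_poly (- 1 :: complex) n) n = of_int z"
    using pdom_eta_poly unfolding pdom_def by (metis Ints_cases)
  then obtain a :: "nat \<Rightarrow> int"
    where a: "\<And>n. coeff (eta_poly (- 1 :: complex) n) n = of_int (a n)" by metis
  have "coeff (eta_poly (- 1 :: complex) 0) 0 = 0" by (simp add: eta_poly_def)
  hence "a 0 = 0" using a[of 0] by simp
  \<comment> \<open>The stabilised coefficients satisfy the defining property, so uniqueness
    identifies them with \<open>eta_coeff\<close>.\<close>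
  hence "is_eta_coeffs a"
    unfolding is_eta_coeffs_altdef using eta_sums a by simp
  hence "a = eta_coeff" using is_eta_coeffs_ex1 is_eta_coeffs_eta_coeff by blast
  thus ?thesis using a by simp
qed

text \<open>The exponents 2k, 4k, 6k and 12k are even, so the product is a series in X^2. Halving
  them gives the factors k, 2k of \<open>phi_theta_product_cong\<close> and their images 3k, 6k
  under q -> q^3.\<close>

lemma fps_of_poly_eta_poly:
  "fps_of_poly (eta_poly (- 1 :: complex) N) = fps_X * (
     ((\<Prod>t<N. 1 - fps_X ^ (t + 1)) * (\<Prod>t<N. 1 - fps_X ^ (2 * t + 2)) *
     ((\<Prod>t<N. 1 - fps_X ^ (3 * (t + 1))) * (\<Prod>t<N. 1 - fps_X ^ (3 * (2 * t + 2))))) oo fps_X ^ 2)"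
proof -
  have e: "fps_of_poly (1 + [:- 1:] * [:0, 1:] ^ m) = 1 - (fps_X :: complex fps) ^ m" for m
    by (simp only: fps_of_poly_add fps_of_poly_mult fps_of_poly_power fps_of_poly_fps_X fps_of_poly_const fps_of_poly_1)
       (simp flip: fps_const_neg)
  have "fps_of_poly (eta_poly (- 1 :: complex) N) = fps_X * (\<Prod>t<N. (1 - fps_X ^ (2 * Suc t)) * (1 - fps_X ^ (4 * Suc t))
                   * (1 - fps_X ^ (6 * Suc t)) * (1 - fps_X ^ (12 * Suc t)))"
    by (simp only: eta_poly_def eta_fac_def fps_of_poly_mult fps_of_poly_prod e fps_of_poly_fps_X)
  moreover have "\<dots> = fps_X * ((\<Prod>t<N. 1 - fps_X ^ (2 * (t + 1))) * (\<Prod>t<N. 1 - fps_X ^ (2 * (2 * t + 2))) *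
     ((\<Prod>t<N. 1 - fps_X ^ (2 * (3 * (t + 1)))) * (\<Prod>t<N. 1 - fps_X ^ (2 * (3 * (2 * t + 2))))))"
  proof -
    have "2 * Suc t = 2 * (t + 1)" "4 * Suc t = 2 * (2 * t + 2)" "6 * Suc t = 2 * (3 * (t + 1))"
      "12 * Suc t = 2 * (3 * (2 * t + 2))" for t by simp_all
    thus ?thesis by (simp only: prod.distrib mult.assoc)
  qed
  moreover have "(fps_X ^ 2 :: complex fps) $ 0 = 0" by simp
  ultimately show ?thesis
    by (simp only: fps_compose_mult_distrib prod_one_minus_compose_X_power zero_less_numeral)
qed

text \<open>\<open>phi_theta_product_cong\<close> and its image under q -> q^3 multiply to 4 F(q)
  F(q^3), whose m-th coefficient sits at q^(2m+1) in 4 q F(q^2) F(q^6).\<close>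

lemma eta_coeff_eq_theta_nth:
  "(phi (- 1) 1 * theta 1 1 * (phi (- 1) 3 * theta 1 3) :: complex fps) $ m = 4 * of_int (eta_coeff (2 * m + 1))"
proof -
  \<comment> \<open>Large enough both for m to lie below the precision 2n + 1 and for the
    coefficient at 2m + 1 to be stable in the product of 2n factors.\<close>
  define n where "n = 2 * m + 1"
  define F where "F = ((\<Prod>t<2 * n. 1 - fps_X ^ (t + 1)) * (\<Prod>t<2 * n. 1 - fps_X ^ (2 * t + 2)) :: complex fps)"
  let ?p = "phi (- 1) 1 :: complex fps" and ?t = "theta 1 1 :: complex fps"
  have F: "fps_cong (2 * n + 1) (?p * ?t) (2 * F)"
    unfolding F_def by (rule phi_theta_product_cong) (simp add: n_def)
  have F3: "fps_cong (2 * n + 1) (phi (- 1) 3 * theta 1 3) (2 * (F oo fps_X ^ 3))"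
  proof -
    have "phi (- 1) 3 = ?p oo fps_X ^ 3" unfolding phi_def by (simp add: gen_fps_scale)
    hence "phi (- 1) 3 * theta 1 3 = (?p * ?t) oo fps_X ^ 3"
      by (simp add: fps_compose_mult_distrib theta_scale[of 3])
    moreover have "2 * (F oo fps_X ^ 3) = (2 * F) oo fps_X ^ 3"
      by (simp add: fps_compose_mult_distrib numeral_fps_const)
    ultimately show ?thesis using fps_cong_compose_X_power[OF F] by simp
  qed
  have "(?p * ?t * (phi (- 1) 3 * theta 1 3)) $ m = (2 * F * (2 * (F oo fps_X ^ 3))) $ m"
    using fps_cong_mult[OF F F3] by (simp add: fps_cong_def n_def)
  also have "2 * F * (2 * (F oo fps_X ^ 3)) = fps_const 4 * (F * (F oo fps_X ^ 3))"
    by (simp add: numeral_fps_const[symmetric])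
  also have "\<dots> $ m = 4 * (F * (F oo fps_X ^ 3)) $ m" by simp
  also have "(F * (F oo fps_X ^ 3)) $ m = fps_of_poly (eta_poly (- 1) (2 * n)) $ (2 * m + 1)"
  proof -
    have "(fps_X * (G oo fps_X ^ 2)) $ (2 * m + 1) = G $ m" for G :: "complex fps"
      by (simp add: fps_nth_compose_X_power)
    moreover have "F oo fps_X ^ 3 = (\<Prod>t<2 * n. 1 - fps_X ^ (3 * (t + 1))) * (\<Prod>t<2 * n. 1 - fps_X ^ (3 * (2 * t + 2)))"
    proof -
      have "(fps_X ^ 3 :: complex fps) $ 0 = 0" by simp
      thus ?thesis
        by (simp only: F_def fps_compose_mult_distrib prod_one_minus_compose_X_power zero_less_numeral)
    qed
    ultimately show ?thesis unfolding fps_of_poly_eta_poly F_def by (simp only:)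
  qed
  also have "\<dots> = of_int (eta_coeff (2 * m + 1))"
    unfolding coeff_eta_poly fps_of_poly_nth by (rule coeff_eta_poly_stable) (simp add: n_def)
  finally show ?thesis .
qed

section \<open>Comparison of coefficients\<close>

lemma tri_count_eq_theta_nth:
  "of_nat (tri_count 1 2 3 6 n) = (theta 1 1 * (theta 1 2 * (theta 1 3 * theta 1 6)) :: 'a::comm_ring_1 fps) $ n"
proof -
  have f: "finite_fibres UNIV (\<lambda>x. 1 * tri x)" "finite_fibres UNIV (\<lambda>x. 2 * tri x)"
     "finite_fibres UNIV (\<lambda>x. 3 * tri x)" "finite_fibres UNIV (\<lambda>x. 6 * tri x)"
    by (intro finite_fibres_theta; simp)+
  note f36 = finite_fibres_times[OF f(3,4)]
  note f236 = finite_fibres_times[OF f(2) f36]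
  have "(theta 1 1 * (theta 1 2 * (theta 1 3 * theta 1 6)) :: 'a fps) =
     gen_fps 1 (UNIV \<times> UNIV \<times> UNIV \<times> UNIV) (\<lambda>(x, v). 1 * tri x + (\<lambda>(y, v). 2 * tri y + (\<lambda>(z, w). 3 * tri z + 6 * tri w) v) v)"
    unfolding theta_def gen_fps_times[OF f(1) f236] gen_fps_times[OF f(2) f36] gen_fps_times[OF f(3,4)] ..
  moreover have "tri_reps 1 2 3 6 n = {v \<in> UNIV \<times> UNIV \<times> UNIV \<times> UNIV.
      (\<lambda>(x, v). 1 * tri x + (\<lambda>(y, v). 2 * tri y + (\<lambda>(z, w). 3 * tri z + 6 * tri w) v) v) v = n}"
  proof -
    have "x * (x - 1) div 2 = int (tri x)" for x using tri_nonneg[of x] by (simp add: tri_def)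
    thus ?thesis by (auto simp: tri_reps_def)
  qed
  ultimately show ?thesis by (simp add: tri_count_def)
qed

theorem theorem3p3:
  fixes n \<beta> n\<^sub>1 :: nat
  assumes "n > 0"
    and "n\<^sub>1 > 0"
    and "2 * n + 3 = 3 ^ \<beta> * n\<^sub>1"
    and "\<not> 3 dvd n\<^sub>1"
  shows "int (tri_count 1 2 3 6 n) = 2 * (3 ^ (\<beta> + 1) - 2) * int (divisor_sigma n\<^sub>1) - 2 * eta_coeff (2 * n + 3)"
proof -
  let ?s = "divisor_sigma (2 * n + 3) + 3 * sigma_third (2 * n + 3)"
  \<comment> \<open>The quaternary theta product appears shifted by X, so coefficients are compared
    at n + 1, which matches the odd number 2(n + 1) + 1 = 2n + 3.\<close>
  have "(hexa_fps * theta 1 1 * theta 1 3 :: complex fps) =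
      phi (- 1) 1 * theta 1 1 * (phi (- 1) 3 * theta 1 3)
      + fps_const 2 * (fps_X * (theta 1 1 * (theta 1 2 * (theta 1 3 * theta 1 6))))"
    unfolding hexa_eq_phi_minus_theta by (simp add: algebra_simps numeral_fps_const[symmetric])
  hence "(hexa_fps * theta 1 1 * theta 1 3 :: complex fps) $ (n + 1) =
      (phi (- 1) 1 * theta 1 1 * (phi (- 1) 3 * theta 1 3)) $ (n + 1)
      + 2 * of_nat (tri_count 1 2 3 6 n)"
    by (simp only: tri_count_eq_theta_nth fps_add_nth fps_mult_left_const_nth) simp
  hence "(4 * of_nat ?s :: complex) = 4 * of_int (eta_coeff (2 * n + 3)) + 2 * of_nat (tri_count 1 2 3 6 n)"
    unfolding hexa_theta_theta_nth eta_coeff_eq_theta_nth by (simp add: eval_nat_numeral)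
  hence "of_int (4 * int ?s) = (of_int (4 * eta_coeff (2 * n + 3) + 2 * int (tri_count 1 2 3 6 n)) :: complex)"
    by simp
  hence "4 * int ?s = 4 * eta_coeff (2 * n + 3) + 2 * int (tri_count 1 2 3 6 n)"
    by (simp only: of_int_eq_iff)
  \<comment> \<open>Half the sum of 3^(beta+1) - 1 and 3 (3^beta - 1) is 3^(beta+1) - 2.\<close>
  moreover have "int ?s = (3 ^ (\<beta> + 1) - 2) * int (divisor_sigma n\<^sub>1)"
  proof -
    have "2 * int (divisor_sigma (2 * n + 3)) + int (divisor_sigma n\<^sub>1) = 3 * 3 ^ \<beta> * int (divisor_sigma n\<^sub>1)"
      using arg_cong[OF divisor_sigma_pow3[OF assms(4), of \<beta>], of int] unfolding assms(3) by simp
    moreover have "2 * int (sigma_third (2 * n + 3)) + int (divisor_sigma n\<^sub>1) = 3 ^ \<beta> * int (divisor_sigma n\<^sub>1)"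
      using arg_cong[OF sigma_third_pow3[OF assms(4), of \<beta>], of int] unfolding assms(3) by simp
    ultimately show ?thesis by (simp add: algebra_simps)
  qed
  ultimately have "4 * ((3 ^ (\<beta> + 1) - 2) * int (divisor_sigma n\<^sub>1)) =
      4 * eta_coeff (2 * n + 3) + 2 * int (tri_count 1 2 3 6 n)" by (simp only:)
  thus ?thesis unfolding mult.assoc by linarith
qed

end
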